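(* Let $\mathcal G$ be a finitely generated group, $S\subseteq\mathcal G$ a finite generating set containing the identity, and $X$ an $S$-Markov shift over an alphabet $\{1,\dots,k\}$. Then the groupoid $\Gamma_X$ is homotopically uniquely generated by $H_X$.
   Context: $S$ need not be symmetric. For a finite alphabet $K$, $K^{\mathcal G}$ has the product topology and the action $\sigma_g(x)_h=x_{g^{-1}h}$. For $\mathcal R\subseteq K^S$, the $S$-Markov shift is $X_{\mathcal R}=\{x:\sigma_g(x)|_S\in\mathcal R\ \forall g\in\mathcal G\}$. A $\mathcal G$-equivariant map $\varphi:X\to Y$ between $S$-Markov shifts over alphabets $K,L$ has neighborhood $T\subseteq\mathcal G$ if $\varphi(x)_g=\varphi_{\mathrm{loc}}(\sigma_{g^{-1}}(x)|_T)$ for some $\varphi_{\mathrm{loc}}:K^T\to L$. $\Gamma$ is the groupoid whose objects are $S$-Markov shifts over alphabets $\{1,\dots,k\}$ ($k\in\mathbb N$) and whose morphisms are $\mathcal G$-equivariant homeomorphisms; $H\subseteq\Gamma^1$ consists of those with neighborhood $S$ whose inverse has neighborhood $S^{-1}$; $\Gamma_X$ is the connected component of $X$ and $H_X=H\cap\Gamma_X^1$. For a groupoid $\Gamma'$ (composition written right to left) and $H'\subseteq\Gamma'^1$: $H'$ generates $\Gamma'$ if it contains all identities and every morphism is a composite of elements of $H'\cup H'^{-1}$. The nerve $\mathcal N(\Gamma',H')$ is the $\Delta$-complex whose $n$-simplices are tuples of objects $(X_0,\dots,X_n)$ with morphisms $\varphi_{i,j}:X_i\to X_j$ in $H'$ ($i<j$)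 such that $\varphi_{j,k}\circ\varphi_{i,j}=\varphi_{i,k}$ for $i<j<k$; a composable sequence in $H'\cup H'^{-1}$ is an edge path in it (edges traversed forward or backward). $H'$ homotopically uniquely generates $\Gamma'$ if $H'$ generates $\Gamma'$ and any two composable sequences in $H'\cup H'^{-1}$ with the same composite are homotopic (rel endpoints) as paths in $\mathcal N(\Gamma',H')$. *)

theory Defs
  imports "HOL-Analysis.Analysis"
begin

text \<open>The group G is an arbitrary type of class group_add (written additively,
  not necessarily commutative): g^{-1}h becomes (- g + h).\<close>

inductive_set gen_subgroup :: "'g::group_add set \<Rightarrow> 'g set" for S where
  gen_zero: "0 \<in> gen_subgroup S"
| gen_base: "s \<in> S \<Longrightarrow> s \<in> gen_subgroup S"
| gen_add: "a \<in> gen_subgroup S \<Longrightarrow> b \<in> gen_subgroup S \<Longrightarrow> a + b \<in> gen_subgroup S"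
| gen_uminus: "a \<in> gen_subgroup S \<Longrightarrow> - a \<in> gen_subgroup S"

definition generates_group :: "'g::group_add set \<Rightarrow> bool" where
  "generates_group S \<longleftrightarrow> gen_subgroup S = UNIV"

definition shift :: "'g::group_add \<Rightarrow> ('g \<Rightarrow> 'a) \<Rightarrow> ('g \<Rightarrow> 'a)" where
  "shift g x = (\<lambda>h. x (- g + h))"

definition full_shift :: "nat \<Rightarrow> ('g \<Rightarrow> nat) set" where
  "full_shift k = {x. \<forall>h. x h \<in> {1..k}}"

definition conf_top :: "nat \<Rightarrow> ('g \<Rightarrow> nat) topology" where
  "conf_top k = product_topology (\<lambda>_. discrete_topology {1..k}) UNIV"

definition markov_of :: "'g::group_add set \<Rightarrow> nat \<Rightarrow> ('g \<Rightarrow> nat) set \<Rightarrow> ('g \<Rightarrow> nat) set" where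
  "markov_of S k R = {x \<in> full_shift k. \<forall>g. restrict (shift g x) S \<in> R}"

definition is_markov_shift :: "'g::group_add set \<Rightarrow> nat \<Rightarrow> ('g \<Rightarrow> nat) set \<Rightarrow> bool" where
  "is_markov_shift S k X \<longleftrightarrow> (\<exists>R. R \<subseteq> PiE S (\<lambda>_. {1..k}) \<and> X = markov_of S k R)"

type_synonym 'g obj = "nat \<times> ('g \<Rightarrow> nat) set"
type_synonym 'g mor = "'g obj \<times> 'g obj \<times> (('g \<Rightarrow> nat) \<Rightarrow> ('g \<Rightarrow> nat))"

definition Obj :: "'g::group_add set \<Rightarrow> 'g obj set" where
  "Obj S = {(k, X). 1 \<le> k \<and> is_markov_shift S k X}"

definition msrc :: "'g mor \<Rightarrow> 'g obj" where "msrc m = fst m"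
definition mtgt :: "'g mor \<Rightarrow> 'g obj" where "mtgt m = fst (snd m)"
definition mfun :: "'g mor \<Rightarrow> (('g \<Rightarrow> nat) \<Rightarrow> ('g \<Rightarrow> nat))" where "mfun m = snd (snd m)"

definition obj_top :: "'g obj \<Rightarrow> ('g \<Rightarrow> nat) topology" where
  "obj_top A = subtopology (conf_top (fst A)) (snd A)"

definition is_mor :: "'g::group_add set \<Rightarrow> 'g mor \<Rightarrow> bool" where
  "is_mor S m \<longleftrightarrow> msrc m \<in> Obj S \<and> mtgt m \<in> Obj S \<and>
     mfun m \<in> extensional (snd (msrc m)) \<and>
     homeomorphic_map (obj_top (msrc m)) (obj_top (mtgt m)) (mfun m) \<and>
     (\<forall>g. \<forall>x \<in> snd (msrc m). mfun m (shift g x) = shift g (mfun m x))"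

definition mcomp :: "'g mor \<Rightarrow> 'g mor \<Rightarrow> 'g mor" where
  "mcomp n m = (msrc m, mtgt n, restrict (mfun n \<circ> mfun m) (snd (msrc m)))"

definition mident :: "'g obj \<Rightarrow> 'g mor" where
  "mident A = (A, A, restrict id (snd A))"

definition minv :: "'g mor \<Rightarrow> 'g mor" where
  "minv m = (mtgt m, msrc m, restrict (inv_into (snd (msrc m)) (mfun m)) (snd (mtgt m)))"

definition has_nbhd :: "'g::group_add set \<Rightarrow> 'g mor \<Rightarrow> bool" where
  "has_nbhd T m \<longleftrightarrow> (\<exists>loc. \<forall>x \<in> snd (msrc m). \<forall>g.
      mfun m x g = loc (restrict (shift (- g) x) T))"

definition Hmor :: "'g::group_add set \<Rightarrow> 'g mor set" where
  "Hmor S = {m. is_mor S m \<and> has_nbhd S m \<and> has_nbhd (uminus ` S) (minv m)}"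

definition comp_obj :: "'g::group_add set \<Rightarrow> 'g obj \<Rightarrow> 'g obj set" where
  "comp_obj S A = {B. \<exists>m. is_mor S m \<and> msrc m = A \<and> mtgt m = B}"

definition comp_mor :: "'g::group_add set \<Rightarrow> 'g obj \<Rightarrow> 'g mor set" where
  "comp_mor S A = {m. is_mor S m \<and> msrc m \<in> comp_obj S A}"

text \<open>A groupoid is given by objects Ob, morphisms Mor, source, target, composition
  (right to left), identities and inverses.  An edge path / composable sequence
  in H \<union> H^{-1} starting at object a is a list of steps (phi, d) with phi \<in> H,
  traversed forward (d = True) or backward (d = False).\<close>

definition step_start :: "('m \<Rightarrow> 'o) \<Rightarrow> ('m \<Rightarrow> 'o) \<Rightarrow> 'm \<times> bool \<Rightarrow> 'o" where
  "step_start src tgt s = (if snd s then src (fst s) else tgt (fst s))"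

definition step_end :: "('m \<Rightarrow> 'o) \<Rightarrow> ('m \<Rightarrow> 'o) \<Rightarrow> 'm \<times> bool \<Rightarrow> 'o" where
  "step_end src tgt s = (if snd s then tgt (fst s) else src (fst s))"

definition step_mor :: "('m \<Rightarrow> 'm) \<Rightarrow> 'm \<times> bool \<Rightarrow> 'm" where
  "step_mor invm s = (if snd s then fst s else invm (fst s))"

fun composable :: "('m \<Rightarrow> 'o) \<Rightarrow> ('m \<Rightarrow> 'o) \<Rightarrow> 'm set \<Rightarrow> 'o \<Rightarrow> ('m \<times> bool) list \<Rightarrow> bool" where
  "composable src tgt H a [] = True"
| "composable src tgt H a (s # ss) \<longleftrightarrow> fst s \<in> H \<and> step_start src tgt s = a \<and>
      composable src tgt H (step_end src tgt s) ss"

fun composite :: "('m \<Rightarrow> 'o) \<Rightarrow> ('m \<Rightarrow> 'o) \<Rightarrow> ('m \<Rightarrow> 'm \<Rightarrow> 'm) \<Rightarrow> ('o \<Rightarrow> 'm) \<Rightarrow> ('m \<Rightarrow> 'm)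
    \<Rightarrow> 'o \<Rightarrow> ('m \<times> bool) list \<Rightarrow> 'm" where
  "composite src tgt cmp ident invm a [] = ident a"
| "composite src tgt cmp ident invm a (s # ss) =
      cmp (composite src tgt cmp ident invm (step_end src tgt s) ss) (step_mor invm s)"

definition gpd_generates :: "'o set \<Rightarrow> 'm set \<Rightarrow> ('m \<Rightarrow> 'o) \<Rightarrow> ('m \<Rightarrow> 'o) \<Rightarrow> ('m \<Rightarrow> 'm \<Rightarrow> 'm)
    \<Rightarrow> ('o \<Rightarrow> 'm) \<Rightarrow> ('m \<Rightarrow> 'm) \<Rightarrow> 'm set \<Rightarrow> bool" where
  "gpd_generates Ob Mor src tgt cmp ident invm H \<longleftrightarrow>
     H \<subseteq> Mor \<and> (\<forall>a \<in> Ob. ident a \<in> H) \<and>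
     (\<forall>m \<in> Mor. \<exists>ss. composable src tgt H (src m) ss \<and>
                      composite src tgt cmp ident invm (src m) ss = m)"

text \<open>Elementary homotopies of edge paths (rel endpoints) in the nerve N(Gamma', H'):
  inserting/removing a backtrack along an edge, and replacing the edge phi_{0,2}
  of a 2-simplex by the two edges phi_{0,1}, phi_{1,2} (or conversely, via symmetry).
  Homotopy of edge paths rel endpoints in the Delta-complex is the equivalence
  relation generated by these moves (combinatorial edge-path homotopy).\<close>

definition nerve_move :: "('m \<Rightarrow> 'o) \<Rightarrow> ('m \<Rightarrow> 'o) \<Rightarrow> ('m \<Rightarrow> 'm \<Rightarrow> 'm) \<Rightarrow> 'm set
    \<Rightarrow> 'o \<times> ('m \<times> bool) list \<Rightarrow> 'o \<times> ('m \<times> bool) list \<Rightarrow> bool" where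
  "nerve_move src tgt cmp H P Q \<longleftrightarrow>
     fst P = fst Q \<and> composable src tgt H (fst P) (snd P) \<and> composable src tgt H (fst Q) (snd Q) \<and>
     ((\<exists>p q \<phi> d. snd P = p @ [(\<phi>, d), (\<phi>, \<not> d)] @ q \<and> snd Q = p @ q) \<or>
      (\<exists>p q f g. f \<in> H \<and> g \<in> H \<and> tgt f = src g \<and> cmp g f \<in> H \<and>
          snd P = p @ [(cmp g f, True)] @ q \<and> snd Q = p @ [(f, True), (g, True)] @ q))"

definition nerve_homotopic :: "('m \<Rightarrow> 'o) \<Rightarrow> ('m \<Rightarrow> 'o) \<Rightarrow> ('m \<Rightarrow> 'm \<Rightarrow> 'm) \<Rightarrow> 'm set
    \<Rightarrow> 'o \<Rightarrow> ('m \<times> bool) list \<Rightarrow> ('m \<times> bool) list \<Rightarrow> bool" where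
  "nerve_homotopic src tgt cmp H a ps qs \<longleftrightarrow> equivclp (nerve_move src tgt cmp H) (a, ps) (a, qs)"

definition homotopically_uniquely_generates :: "'o set \<Rightarrow> 'm set \<Rightarrow> ('m \<Rightarrow> 'o) \<Rightarrow> ('m \<Rightarrow> 'o)
    \<Rightarrow> ('m \<Rightarrow> 'm \<Rightarrow> 'm) \<Rightarrow> ('o \<Rightarrow> 'm) \<Rightarrow> ('m \<Rightarrow> 'm) \<Rightarrow> 'm set \<Rightarrow> bool" where
  "homotopically_uniquely_generates Ob Mor src tgt cmp ident invm H \<longleftrightarrow>
     gpd_generates Ob Mor src tgt cmp ident invm H \<and>
     (\<forall>a \<in> Ob. \<forall>ps qs. composable src tgt H a ps \<longrightarrow> composable src tgt H a qs \<longrightarrow>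
        composite src tgt cmp ident invm a ps = composite src tgt cmp ident invm a qs \<longrightarrow>
        nerve_homotopic src tgt cmp H a ps qs)"

end

(* Fix an object b. A morphism m out of b is, up to relabelling, the clopen partition ker m of X = snd b
   given by the symbol of m x at 0, and the transition from m to n lies in H exactly if ker n is coarser
   than the S-block refinement of ker m and ker m is coarser than the S^{-1}-block refinement of ker n.
   Lifting edge paths to these partitions turns the theorem into: the complex of Markov partitions of X is
   connected and simply connected.

   If Q is any partition coarser than ker m, then joining ker m with the S-block or the S^{-1}-block
   refinement of Q yields another Markov partition joined to m by an edge, and this operation is a
   simplicial homotopy on the part of the complex that refines Q. As S generates the group, iterating it
   brings finitely many given vertices to one and the same partition; hence two paths with the same ends
   are homotopic as soon as all their vertices refine one vertex Q. An arbitrary edge from m to n passes,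
   up to homotopy, through the join of ker m and ker n, so a path is homotopic to the product of such
   monotone paths from its two ends to a common refinement of all its vertices, and that product depends
   on the ends only. *)


theory Submission
  imports Defs
begin

subsection \<open>Homotopy of vertex paths\<close>

text \<open>The orientation of E is kept because the 2-simplices of the nerve are ordered: triangles
  contract only along x, y, z, backtracks in either direction. The surrounding lists p and q are
  arbitrary, which makes the relation a congruence for concatenation.\<close>

inductive path_hom :: "('v \<Rightarrow> 'v \<Rightarrow> bool) \<Rightarrow> 'v list \<Rightarrow> 'v list \<Rightarrow> bool" for E where
  hom_refl: "path_hom E u u"
| hom_sym: "path_hom E u v \<Longrightarrow> path_hom E v u"
| hom_trans: "path_hom E u v \<Longrightarrow> path_hom E v w \<Longrightarrow> path_hom E u w"
| hom_back: "E x y \<or> E y x \<Longrightarrow> path_hom E (p @ [x, y, x] @ q) (p @ [x] @ q)"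
| hom_tri: "E x y \<Longrightarrow> E y z \<Longrightarrow> E x z \<Longrightarrow> path_hom E (p @ [x, y, z] @ q) (p @ [x, z] @ q)"

declare path_hom.hom_refl [simp, intro]
lemmas [trans] = path_hom.hom_trans

abbreviation adj :: "('v \<Rightarrow> 'v \<Rightarrow> bool) \<Rightarrow> 'v \<Rightarrow> 'v \<Rightarrow> bool" where
  "adj E x y \<equiv> E x y \<or> E y x"

definition epath :: "('v \<Rightarrow> 'v \<Rightarrow> bool) \<Rightarrow> 'v \<Rightarrow> 'v list \<Rightarrow> 'v \<Rightarrow> bool" where
  "epath E x u y \<longleftrightarrow> u \<noteq> [] \<and> hd u = x \<and> last u = y \<and> successively (adj E) u"

lemma path_hom_cong:
  assumes "path_hom E u v"
  shows "path_hom E (p @ u @ q) (p @ v @ q)"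
  using assms
proof (induction rule: path_hom.induct)
  case (hom_back x y p' q')
  show ?case using path_hom.hom_back[of E x y "p @ p'" "q' @ q"] hom_back by simp
next
  case (hom_tri x y z p' q')
  show ?case using path_hom.hom_tri[of E x y z "p @ p'" "q' @ q"] hom_tri by simp
qed (auto intro: path_hom.intros)

lemma path_hom_append_left: "path_hom E u v \<Longrightarrow> path_hom E (p @ u) (p @ v)"
  using path_hom_cong[of E u v p "[]"] by simp

lemma path_hom_append_right: "path_hom E u v \<Longrightarrow> path_hom E (u @ q) (v @ q)"
  using path_hom_cong[of E u v "[]" q] by simp

lemma path_hom_Cons: "path_hom E u v \<Longrightarrow> path_hom E (x # u) (x # v)"
  using path_hom_append_left[of E u v "[x]"] by simp

lemma path_hom_backtrack: "adj E x y \<Longrightarrow> path_hom E (x # y # x # q) (x # q)"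
  using path_hom.hom_back[of E x y "[]" q] by simp

lemma path_hom_backtrack2: "adj E x y \<Longrightarrow> path_hom E (z # x # y # x # q) (z # x # q)"
  by (simp add: path_hom_Cons path_hom_backtrack)

section \<open>Triangles and squares in arbitrary orientation\<close>

lemma triangle_swap_left:
  assumes "path_hom E [x, y, z] [x, z]" "adj E x y"
  shows "path_hom E [y, x, z] [y, z]"
proof -
  have "path_hom E [y, x, z] [y, x, y, z]"
    using path_hom_Cons[OF path_hom.hom_sym[OF assms(1)]] by simp
  also have "path_hom E \<dots> [y, z]" using assms(2) by (intro path_hom_backtrack) blast
  finally show ?thesis .
qed

lemma triangle_swap_right:
  assumes "path_hom E [x, y, z] [x, z]" "adj E y z"
  shows "path_hom E [x, z, y] [x, y]"
proof -
  have "path_hom E [x, z, y] [x, y, z, y]"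
    using path_hom_append_right[OF path_hom.hom_sym[OF assms(1)], of "[y]"] by simp
  also have "path_hom E \<dots> [x, y]" using assms(2) by (intro path_hom_backtrack2) blast
  finally show ?thesis .
qed

text \<open>Only the order x, y, z is a generating move. Inserting a backtrack and contracting
  exchanges the first two or the last two vertices, and these exchanges reach the other five
  orders.\<close>

lemma triangle:
  assumes "E x y" "E y z" "E x z"
  shows "path_hom E [x, y, z] [x, z]" "path_hom E [y, x, z] [y, z]" "path_hom E [x, z, y] [x, y]"
    "path_hom E [y, z, x] [y, x]" "path_hom E [z, x, y] [z, y]" "path_hom E [z, y, x] [z, x]"
proof -
  show 1: "path_hom E [x, y, z] [x, z]" using path_hom.hom_tri[OF assms, of "[]" "[]"] by simp
  show 2: "path_hom E [y, x, z] [y, z]" using triangle_swap_left[OF 1] assms by blast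
  show 3: "path_hom E [x, z, y] [x, y]" using triangle_swap_right[OF 1] assms by blast
  show 4: "path_hom E [y, z, x] [y, x]" using triangle_swap_right[OF 2] assms by blast
  show 5: "path_hom E [z, x, y] [z, y]" using triangle_swap_left[OF 3] assms by blast
  show "path_hom E [z, y, x] [z, x]" using triangle_swap_right[OF 5] assms by blast
qed

text \<open>The square is cut along the diagonal from x to y'; in \<open>square'\<close> it is cut
  along the one from y to x'. Which diagonal is available depends on the orientation of the
  sides.\<close>

lemma square:
  assumes "path_hom E [x, y, y'] [x, y']" "path_hom E [x, x', y'] [x, y']"
  shows "path_hom E [x, y, y'] [x, x', y']"
  using path_hom.hom_trans[OF assms(1) path_hom.hom_sym[OF assms(2)]] .

lemma square':
  assumes "path_hom E [x, y, x'] [x, x']" "path_hom E [y, x', y'] [y, y']"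
  shows "path_hom E [x, y, y'] [x, x', y']"
proof -
  have "path_hom E [x, y, y'] [x, y, x', y']"
    using path_hom_Cons[OF path_hom.hom_sym[OF assms(2)]] by simp
  also have "path_hom E \<dots> [x, x', y']"
    using path_hom_append_right[OF assms(1), of "[y']"] by simp
  finally show ?thesis .
qed

text \<open>F moves every vertex along a rung, and the squares between consecutive rungs push the
  path over one edge at a time; the two outer rungs remain as first and last edge.\<close>

lemma path_hom_map:
  assumes "successively (adj E) u" "u \<noteq> []" "\<And>x. x \<in> set u \<Longrightarrow> adj E x (F x)"
    and "\<And>x y. x \<in> set u \<Longrightarrow> y \<in> set u \<Longrightarrow> adj E x y \<Longrightarrow> path_hom E [x, y, F y] [x, F x, F y]"
  shows "path_hom E u (hd u # map F u @ [last u])"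
  using assms
proof (induction u rule: induct_list012)
  case (2 x)
  show ?case using path_hom.hom_sym[OF path_hom_backtrack[of E x "F x" "[]"]] 2 by simp
next
  case (3 x y r)
  let ?t = "map F r @ [last (y # r)]"
  have "path_hom E (y # r) (hd (y # r) # map F (y # r) @ [last (y # r)])"
    by (rule "3.IH"(2)) (use "3.prems" in auto)
  then have "path_hom E (y # r) ([y, F y] @ ?t)" by simp
  then have "path_hom E (x # y # r) ([x, y, F y] @ ?t)" by (simp add: path_hom_Cons)
  also have "path_hom E \<dots> ([x, F x, F y] @ ?t)"
    by (rule path_hom_append_right) (use "3.prems" in auto)
  finally show ?case by simp
qed simp

lemma epath_append:
  assumes "epath E x u y" "epath E y v z"
  shows "epath E x (u @ tl v) z"
proof (cases v)
  case (Cons a w)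
  show ?thesis
  proof (cases w)
    case (Cons c w')
    then show ?thesis using assms \<open>v = a # w\<close>
      by (auto simp: epath_def successively_append_iff)
  qed (use assms Cons in \<open>auto simp: epath_def\<close>)
qed (use assms in \<open>auto simp: epath_def\<close>)

lemma epath_rev: "epath E x u y \<Longrightarrow> epath E y (rev u) x"
  by (simp add: epath_def hd_rev last_rev disj_commute)

lemma path_hom_rev_cancel:
  assumes "epath E x u y"
  shows "path_hom E (u @ tl (rev u)) [x]"
  using assms
proof (induction u arbitrary: x rule: induct_list012)
  case (3 a b r)
  have "path_hom E ((b # r) @ tl (rev (b # r))) [b]"
    by (rule "3.IH"(2)) (use "3.prems" in \<open>auto simp: epath_def\<close>)
  then have "path_hom E ([a] @ ((b # r) @ tl (rev (b # r))) @ [a]) ([a] @ [b] @ [a])"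
    by (rule path_hom_cong)
  moreover have "path_hom E [a, b, a] [a]"
    using "3.prems" by (intro path_hom_backtrack) (auto simp: epath_def)
  moreover have "tl (rev (a # b # r)) = tl (rev (b # r)) @ [a]" by (cases "rev r") simp_all
  ultimately have "path_hom E ((a # b # r) @ tl (rev (a # b # r))) [a]"
    using path_hom.hom_trans[of E "[a] @ ((b # r) @ tl (rev (b # r))) @ [a]" "[a, b, a]" "[a]"] by simp
  then show ?case using "3.prems" by (simp add: epath_def)
qed (auto simp: epath_def)

text \<open>Each elementary move preserves the ends and the adjacency of consecutive vertices in
  both directions, so being a path is invariant although \<open>path_hom\<close> is defined on all
  lists.\<close>

lemma path_hom_epath:
  assumes "path_hom E u v"
  shows "epath E x u y \<longleftrightarrow> epath E x v y"
  using assms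
proof (induction rule: path_hom.induct)
  case (hom_back a b p q)
  then show ?case
    unfolding epath_def
    by (cases "p = []"; cases "q = []"; simp add: successively_append_iff successively_Cons; blast)
next
  case (hom_tri a b c p q)
  then show ?case
    unfolding epath_def
    by (cases "p = []"; cases "q = []"; simp add: successively_append_iff successively_Cons; blast)
qed simp_all

lemma path_hom_clique:
  assumes "u \<noteq> []" "\<And>x y. x \<in> set u \<Longrightarrow> y \<in> set u \<Longrightarrow> E x y"
  shows "path_hom E u [hd u, last u]"
  using assms
proof (induction u rule: induct_list012)
  case (2 x)
  \<comment> \<open>The list x, x, x contracts to x as a backtrack and to x, x as a degenerate
    triangle, which identifies the constant path with the loop.\<close>
  have "E x x" using 2 by simp
  then have "path_hom E [x, x, x] [x]" "path_hom E [x, x, x] [x, x]"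
    using path_hom_backtrack[of E x x "[]"] triangle(1)[of E x x x] by auto
  then show ?case using path_hom.hom_trans[OF path_hom.hom_sym] by auto
next
  case (3 x y r)
  have "path_hom E (y # r) [y, last (y # r)]"
    using "3.IH"(2) "3.prems" by simp
  then have "path_hom E (x # y # r) [x, y, last (y # r)]" by (simp add: path_hom_Cons)
  also have "path_hom E \<dots> [x, last (y # r)]"
    by (rule triangle(1)) (use "3.prems" in auto)
  finally show ?case by simp
qed simp

text \<open>Walking back along \<open>rev d\<close> undoes the appended \<open>tl d\<close>; doing
  so on both sides turns the given homotopy into the wanted one.\<close>

lemma path_hom_append_cancel:
  assumes "epath E x u y" "epath E x v y" "epath E y d z" "path_hom E (u @ tl d) (v @ tl d)"
  shows "path_hom E u v"
proof -
  have *: "path_hom E ((w @ tl d) @ tl (rev d)) w" if w: "epath E x w y" for w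
  proof -
    have "path_hom E (d @ tl (rev d)) [y]" using path_hom_rev_cancel assms(3) .
    then have "path_hom E (butlast w @ d @ tl (rev d)) (butlast w @ [y])"
      by (rule path_hom_append_left)
    moreover have "butlast w @ [y] = w" using w by (auto simp: epath_def)
    moreover have "d = y # tl d" using assms(3) by (cases d) (auto simp: epath_def)
    then have "butlast w @ d = w @ tl d"
      using \<open>butlast w @ [y] = w\<close> by (metis append.assoc append_Cons append_Nil)
    ultimately show ?thesis by (metis append.assoc)
  qed
  have "path_hom E u ((u @ tl d) @ tl (rev d))" using *[OF assms(1)] by (rule path_hom.hom_sym)
  also have "path_hom E \<dots> ((v @ tl d) @ tl (rev d))"
    using assms(4) by (rule path_hom_append_right)
  also have "path_hom E \<dots> v" using *[OF assms(2)] .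
  finally show ?thesis .
qed

subsection \<open>Local maps and continuity\<close>

lemma shift_shift: "shift g (shift h x) = shift (g + h) x"
  unfolding shift_def by (metis minus_add add.assoc)

lemma shift_zero [simp]: "shift 0 x = x"
  by (simp add: shift_def)

lemma shift_apply: "shift (- g) x h = x (g + h)"
  by (simp add: shift_def)

lemma topspace_conf_top [simp]: "topspace (conf_top k) = full_shift k"
  by (auto simp: conf_top_def full_shift_def PiE_UNIV_domain)

lemma compact_conf_top: "compact_space (conf_top k)"
  by (simp add: conf_top_def compact_space_product_topology compact_space_discrete_topology)

lemma Hausdorff_conf_top: "Hausdorff_space (conf_top k)"
  by (simp add: conf_top_def Hausdorff_space_product_topology)

lemma openin_conf_top_local:
  assumes "finite T" "U \<subseteq> full_shift k"
    and "\<And>x y. x \<in> U \<Longrightarrow> y \<in> full_shift k \<Longrightarrow> (\<And>t. t \<in> T \<Longrightarrow> x t = y t) \<Longrightarrow> y \<in> U"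
  shows "openin (conf_top k) U"
  unfolding conf_top_def openin_product_topology_alt
proof (intro ballI)
  fix x assume x: "x \<in> U"
  let ?V = "\<lambda>t. if t \<in> T then {x t} else {1..k}"
  have "{t. ?V t \<noteq> {1..k}} \<subseteq> T" by auto
  then have "finite {t. ?V t \<noteq> {1..k}}" using assms(1) finite_subset by blast
  moreover have "x \<in> Pi\<^sub>E UNIV ?V" using x assms(2) by (auto simp: full_shift_def)
  moreover have "Pi\<^sub>E UNIV ?V \<subseteq> U"
  proof
    fix y assume "y \<in> Pi\<^sub>E UNIV ?V"
    then have y: "y t \<in> ?V t" for t by (rule PiE_mem) simp
    have "y t \<in> {1..k}" for t
      using y[of t] x assms(2) by (cases "t \<in> T") (auto simp: full_shift_def split: if_splits)
    then have "y \<in> full_shift k" by (auto simp: full_shift_def)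
    then show "y \<in> U"
      using assms(3)[OF x, of y] y by (metis singletonD)
  qed
  moreover have "openin (discrete_topology {1..k}) (?V t)" for t
    using x assms(2) by (auto simp: full_shift_def)
  ultimately show "\<exists>V. finite {i \<in> UNIV. V i \<noteq> topspace (discrete_topology {1..k})} \<and>
      (\<forall>i\<in>UNIV. openin (discrete_topology {1..k}) (V i)) \<and> x \<in> Pi\<^sub>E UNIV V \<and> Pi\<^sub>E UNIV V \<subseteq> U"
    by (intro exI[of _ ?V]) simp
qed

lemma Obj_subset: "A \<in> Obj S \<Longrightarrow> snd A \<subseteq> full_shift (fst A)"
  by (auto simp: Obj_def is_markov_shift_def markov_of_def)

lemma Obj_shift: "A \<in> Obj S \<Longrightarrow> x \<in> snd A \<Longrightarrow> shift g x \<in> snd A"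
  by (auto simp: Obj_def is_markov_shift_def markov_of_def shift_shift)
    (auto simp: full_shift_def shift_def)

text \<open>A configuration lies outside the shift exactly if some translate shows a forbidden
  S-pattern. For each translate this is a condition on finitely many coordinates, so the complement
  is a union of open sets.\<close>

lemma closedin_Obj:
  assumes "A \<in> Obj S" "finite S"
  shows "closedin (conf_top (fst A)) (snd A)"
proof -
  obtain k X where A: "A = (k, X)" by (cases A)
  then obtain R where R: "X = markov_of S k R"
    using assms(1) by (auto simp: Obj_def is_markov_shift_def)
  have "openin (conf_top k) {x \<in> full_shift k. restrict (shift g x) S \<notin> R}" (is "openin _ ?U") for g
  proof (rule openin_conf_top_local[of "(\<lambda>s. - g + s) ` S"])
    fix x y assume x: "x \<in> ?U" and y: "y \<in> full_shift k"
      and "\<And>t. t \<in> (\<lambda>s. - g + s) ` S \<Longrightarrow> x t = y t"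
    then have "restrict (shift g x) S = restrict (shift g y) S"
      by (auto simp: shift_def restrict_def)
    then show "y \<in> ?U" using x y by simp
  qed (use assms(2) in auto)
  then have "openin (conf_top k) (\<Union>g. {x \<in> full_shift k. restrict (shift g x) S \<notin> R})"
    by blast
  moreover have "full_shift k - X = (\<Union>g. {x \<in> full_shift k. restrict (shift g x) S \<notin> R})"
    unfolding R markov_of_def by blast
  moreover have "X \<subseteq> full_shift k" using Obj_subset[OF assms(1)] A by simp
  ultimately show ?thesis by (simp add: closedin_def A)
qed

lemma topspace_obj_top [simp]: "A \<in> Obj S \<Longrightarrow> topspace (obj_top A) = snd A"
  using Obj_subset[of A S] by (auto simp: obj_top_def)

lemma compact_obj_top: "A \<in> Obj S \<Longrightarrow> finite S \<Longrightarrow> compact_space (obj_top A)"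
  unfolding obj_top_def
  by (simp add: closedin_Obj closedin_compact_space compact_conf_top compact_space_subtopology)

lemma Hausdorff_obj_top: "Hausdorff_space (obj_top A)"
  unfolding obj_top_def by (simp add: Hausdorff_conf_top Hausdorff_space_subtopology)

lemma openin_conf_top_cylinder:
  assumes "openin (conf_top k) W" "x \<in> W"
  obtains T where "finite T" "\<And>y. y \<in> full_shift k \<Longrightarrow> (\<And>t. t \<in> T \<Longrightarrow> y t = x t) \<Longrightarrow> y \<in> W"
proof -
  obtain V where V: "finite {i. V i \<noteq> {1..k}}" "x \<in> Pi\<^sub>E UNIV V" "Pi\<^sub>E UNIV V \<subseteq> W"
    using assms unfolding conf_top_def openin_product_topology_alt by fastforce
  show ?thesis
  proof
    show "y \<in> W" if "y \<in> full_shift k" "\<And>t. t \<in> {i. V i \<noteq> {1..k}} \<Longrightarrow> y t = x t" for y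
    proof -
      have "y t \<in> V t" for t
        using that V(2) by (cases "V t = {1..k}") (auto simp: full_shift_def)
      then show ?thesis using V(3) by auto
    qed
  qed (use V in simp)
qed

text \<open>This is the Curtis-Hedlund-Lyndon argument: every point has a finite window that decides
  f near it, and compactness leaves finitely many windows, whose union serves all points.\<close>

lemma continuous_discrete_imp_local:
  assumes A: "A \<in> Obj S" "finite S"
    and f: "continuous_map (obj_top A) (discrete_topology D) f"
  obtains T where "finite T"
    "\<And>x y. x \<in> snd A \<Longrightarrow> y \<in> snd A \<Longrightarrow> (\<And>t. t \<in> T \<Longrightarrow> x t = y t) \<Longrightarrow> f x = f y"
proof -
  have "\<exists>T. finite T \<and> (\<forall>y \<in> snd A. (\<forall>t\<in>T. y t = x t) \<longrightarrow> f y = f x)" if x: "x \<in> snd A" for x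
  proof -
    have "f x \<in> D" using f x A(1) by (auto simp: continuous_map_def)
    then have "openin (obj_top A) {y \<in> snd A. f y \<in> {f x}}"
      using openin_continuous_map_preimage[OF f, of "{f x}"] A(1) by simp
    then obtain W where W: "openin (conf_top (fst A)) W" "{y \<in> snd A. f y \<in> {f x}} = W \<inter> snd A"
      by (auto simp: obj_top_def openin_subtopology)
    then have "x \<in> W" using x by auto
    then obtain T where "finite T"
      "\<And>y. y \<in> full_shift (fst A) \<Longrightarrow> (\<And>t. t \<in> T \<Longrightarrow> y t = x t) \<Longrightarrow> y \<in> W"
      using openin_conf_top_cylinder[OF W(1)] by metis
    then show ?thesis using W(2) Obj_subset[OF A(1)] by (intro exI[of _ T]) blast
  qed
  then obtain \<tau> where \<tau>: "\<And>x. x \<in> snd A \<Longrightarrow> finite (\<tau> x)"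
    "\<And>x y. x \<in> snd A \<Longrightarrow> y \<in> snd A \<Longrightarrow> (\<And>t. t \<in> \<tau> x \<Longrightarrow> y t = x t) \<Longrightarrow> f y = f x"
    by metis
  define C where "C x = {y \<in> full_shift (fst A). \<forall>t \<in> \<tau> x. y t = x t}" for x
  have op: "openin (conf_top (fst A)) (C x)" if "x \<in> snd A" for x
    by (rule openin_conf_top_local[of "\<tau> x"]) (use \<tau>(1) that in \<open>auto simp: C_def\<close>)
  have "compactin (conf_top (fst A)) (snd A)"
    using closedin_Obj[OF A] by (simp add: closedin_compact_space compact_conf_top)
  moreover have "snd A \<subseteq> \<Union> (C ` snd A)"
    using Obj_subset[OF A(1)] by (auto simp: C_def)
  ultimately obtain \<F> where "finite \<F>" "\<F> \<subseteq> C ` snd A" "snd A \<subseteq> \<Union>\<F>"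
    using op unfolding compactin_def by (metis (mono_tags, lifting) imageE)
  then obtain F where F: "finite F" "F \<subseteq> snd A" "snd A \<subseteq> \<Union> (C ` F)"
    by (metis finite_subset_image)
  show ?thesis
  proof
    show "finite (\<Union> (\<tau> ` F))" using F \<tau>(1) by auto
    fix x y assume x: "x \<in> snd A" and y: "y \<in> snd A" and eq: "\<And>t. t \<in> \<Union> (\<tau> ` F) \<Longrightarrow> x t = y t"
    obtain z where z: "z \<in> F" "x \<in> C z" using F x by blast
    then have "f x = f z" using \<tau>(2)[of z x] F x by (auto simp: C_def)
    moreover have "f y = f z" using \<tau>(2)[of z y] F y z eq by (fastforce simp: C_def)
    ultimately show "f x = f y" by simp
  qed
qed

subsection \<open>The groupoid of Markov shifts\<close>

lemma is_morD:
  assumes "is_mor S m"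
  shows "msrc m \<in> Obj S" "mtgt m \<in> Obj S" "mfun m \<in> extensional (snd (msrc m))"
    "homeomorphic_map (obj_top (msrc m)) (obj_top (mtgt m)) (mfun m)"
    "\<And>g x. x \<in> snd (msrc m) \<Longrightarrow> mfun m (shift g x) = shift g (mfun m x)"
    "bij_betw (mfun m) (snd (msrc m)) (snd (mtgt m))"
proof -
  show *: "msrc m \<in> Obj S" "mtgt m \<in> Obj S" "mfun m \<in> extensional (snd (msrc m))"
    "homeomorphic_map (obj_top (msrc m)) (obj_top (mtgt m)) (mfun m)"
    "\<And>g x. x \<in> snd (msrc m) \<Longrightarrow> mfun m (shift g x) = shift g (mfun m x)"
    using assms by (auto simp: is_mor_def)
  show "bij_betw (mfun m) (snd (msrc m)) (snd (mtgt m))"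
    using homeomorphic_imp_injective_map[OF *(4)] homeomorphic_imp_surjective_map[OF *(4)] *(1,2)
    by (simp add: bij_betw_def)
qed

lemma msrc_mcomp [simp]: "msrc (mcomp n m) = msrc m"
  and mtgt_mcomp [simp]: "mtgt (mcomp n m) = mtgt n"
  and mfun_mcomp: "mfun (mcomp n m) = restrict (mfun n \<circ> mfun m) (snd (msrc m))"
  and msrc_minv [simp]: "msrc (minv m) = mtgt m"
  and mtgt_minv [simp]: "mtgt (minv m) = msrc m"
  and mfun_minv: "mfun (minv m) = restrict (inv_into (snd (msrc m)) (mfun m)) (snd (mtgt m))"
  and msrc_mident [simp]: "msrc (mident A) = A"
  and mtgt_mident [simp]: "mtgt (mident A) = A"
  and mfun_mident: "mfun (mident A) = restrict id (snd A)"
  by (simp_all add: mcomp_def minv_def mident_def msrc_def mtgt_def mfun_def)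

lemma mor_eqI: "msrc m = msrc n \<Longrightarrow> mtgt m = mtgt n \<Longrightarrow> mfun m = mfun n \<Longrightarrow> m = n"
  by (simp add: msrc_def mtgt_def mfun_def prod_eq_iff)

lemma mor_eqI':
  assumes "is_mor S m" "is_mor S n" "msrc m = msrc n" "mtgt m = mtgt n"
    and "\<And>x. x \<in> snd (msrc m) \<Longrightarrow> mfun m x = mfun n x"
  shows "m = n"
  using assms is_morD(3) by (metis mor_eqI extensionalityI)

lemma mfun_in: "is_mor S m \<Longrightarrow> x \<in> snd (msrc m) \<Longrightarrow> mfun m x \<in> snd (mtgt m)"
  using is_morD(6) by (metis bij_betwE)

lemma is_mor_mident: "A \<in> Obj S \<Longrightarrow> is_mor S (mident A)"
  unfolding is_mor_def mfun_mident
  by (auto simp: Obj_shift intro: homeomorphic_map_eq[OF homeomorphic_map_id[THEN iffD2], OF refl])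

lemma is_mor_mcomp:
  assumes m: "is_mor S m" and n: "is_mor S n" and eq: "mtgt m = msrc n"
  shows "is_mor S (mcomp n m)"
proof -
  have "homeomorphic_map (obj_top (msrc m)) (obj_top (mtgt n)) (mfun n \<circ> mfun m)"
    using is_morD(4)[OF m] is_morD(4)[OF n] eq homeomorphic_map_compose by metis
  then have "homeomorphic_map (obj_top (msrc m)) (obj_top (mtgt n)) (mfun (mcomp n m))"
    by (rule homeomorphic_map_eq) (use is_morD(1)[OF m] in \<open>simp add: mfun_mcomp\<close>)
  then show ?thesis
    using is_morD[OF m] is_morD[OF n] eq mfun_in[OF m] Obj_shift[OF is_morD(1)[OF m]]
    unfolding is_mor_def by (simp add: mfun_mcomp)
qed

lemma mfun_minv_mfun: "is_mor S m \<Longrightarrow> x \<in> snd (msrc m) \<Longrightarrow> mfun (minv m) (mfun m x) = x"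
  using is_morD(6)[of S m] mfun_in[of S m x] by (simp add: mfun_minv bij_betw_def)

lemma mfun_surj:
  assumes "is_mor S m" "y \<in> snd (mtgt m)"
  obtains x where "x \<in> snd (msrc m)" "y = mfun m x"
  using is_morD(6)[OF assms(1)] assms(2) unfolding bij_betw_def by blast

lemma is_mor_minv:
  assumes m: "is_mor S m"
  shows "is_mor S (minv m)"
proof -
  have "\<exists>g. homeomorphic_maps (obj_top (msrc m)) (obj_top (mtgt m)) (mfun m) g"
    using is_morD(4)[OF m] by (simp add: homeomorphic_map_maps)
  then obtain g where g: "homeomorphic_maps (obj_top (msrc m)) (obj_top (mtgt m)) (mfun m) g"
    by blast
  then have "homeomorphic_map (obj_top (mtgt m)) (obj_top (msrc m)) g"
    using homeomorphic_maps_map by blast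
  moreover have "g y = mfun (minv m) y" if y: "y \<in> snd (mtgt m)" for y
  proof -
    obtain x where x: "x \<in> snd (msrc m)" "y = mfun m x" using mfun_surj[OF m y] .
    then show ?thesis using g mfun_minv_mfun[OF m x(1)] is_morD(1)[OF m]
      by (simp add: homeomorphic_maps_def)
  qed
  ultimately have "homeomorphic_map (obj_top (mtgt m)) (obj_top (msrc m)) (mfun (minv m))"
    by (rule homeomorphic_map_eq) (use is_morD(2)[OF m] in simp)
  moreover have "mfun (minv m) (shift g y) = shift g (mfun (minv m) y)"
    if y: "y \<in> snd (mtgt m)" for g y
  proof -
    obtain x where x: "x \<in> snd (msrc m)" "y = mfun m x" using mfun_surj[OF m y] .
    then have "shift g y = mfun m (shift g x)" using is_morD(5)[OF m] by simp
    then show ?thesis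
      using mfun_minv_mfun[OF m] x Obj_shift[OF is_morD(1)[OF m] x(1)] by simp
  qed
  ultimately show ?thesis using is_morD(1,2)[OF m] by (simp add: is_mor_def mfun_minv)
qed

text \<open>Equivariance transports every coordinate to 0, so a local rule exists as soon as the
  symbol at 0 is a well-defined function of the pattern on T.\<close>

lemma has_nbhd_iff:
  assumes m: "is_mor S m"
  shows "has_nbhd T m \<longleftrightarrow> (\<forall>x \<in> snd (msrc m). \<forall>y \<in> snd (msrc m).
    (\<forall>t\<in>T. x t = y t) \<longrightarrow> mfun m x 0 = mfun m y 0)" (is "_ = ?R")
proof
  assume "has_nbhd T m"
  then obtain loc where loc: "\<And>x g. x \<in> snd (msrc m) \<Longrightarrow> mfun m x g = loc (restrict (shift (- g) x) T)"
    by (auto simp: has_nbhd_def)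
  have "restrict x T = restrict y T" if "\<forall>t\<in>T. x t = y t" for x y :: "_ \<Rightarrow> nat"
    using that by (auto simp: restrict_def)
  moreover have "mfun m x 0 = loc (restrict x T)" if "x \<in> snd (msrc m)" for x
    using loc[OF that, of 0] by simp
  ultimately show ?R by metis
next
  assume R: ?R
  \<comment> \<open>A pattern is evaluated on some point showing it; on patterns that do not occur
    the value is arbitrary.\<close>
  define loc where "loc p = mfun m (SOME x. x \<in> snd (msrc m) \<and> restrict x T = p) 0" for p
  have "mfun m x g = loc (restrict (shift (- g) x) T)" if x: "x \<in> snd (msrc m)" for x g
  proof -
    let ?x = "shift (- g) x"
    let ?y = "SOME y. y \<in> snd (msrc m) \<and> restrict y T = restrict ?x T"
    have x': "?x \<in> snd (msrc m)" using x Obj_shift[OF is_morD(1)[OF m]] by blast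
    then obtain y where y: "y = ?y" "y \<in> snd (msrc m)" "restrict y T = restrict ?x T"
      using someI[of "\<lambda>y. y \<in> snd (msrc m) \<and> restrict y T = restrict ?x T" ?x] by auto
    have "?x t = y t" if "t \<in> T" for t
      using fun_cong[OF y(3), of t] that by simp
    then have "mfun m ?x 0 = mfun m ?y 0" using R x' y(2) unfolding y(1)[symmetric] by blast
    moreover have "mfun m ?x 0 = mfun m x g" using is_morD(5)[OF m x] by (simp add: shift_apply)
    ultimately show ?thesis by (simp add: loc_def)
  qed
  then show "has_nbhd T m" by (auto simp: has_nbhd_def)
qed

subsection \<open>Partitions\<close>

text \<open>Equivalence relations on the shift space stand for partitions: a smaller relation is a finer
  partition, and \<open>block X T Q\<close> is the join of the translates of Q by T.\<close>

definition block :: "('g::group_add \<Rightarrow> nat) set \<Rightarrow> 'g set \<Rightarrow> (('g \<Rightarrow> nat) \<times> ('g \<Rightarrow> nat)) set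
    \<Rightarrow> (('g \<Rightarrow> nat) \<times> ('g \<Rightarrow> nat)) set" where
  "block X T Q = {(x, y) \<in> X \<times> X. \<forall>t\<in>T. (shift (- t) x, shift (- t) y) \<in> Q}"

definition ker :: "'g::group_add mor \<Rightarrow> (('g \<Rightarrow> nat) \<times> ('g \<Rightarrow> nat)) set" where
  "ker m = {(x, y). x \<in> snd (msrc m) \<and> y \<in> snd (msrc m) \<and> mfun m x 0 = mfun m y 0}"

lemma block_mono: "Q \<subseteq> Q' \<Longrightarrow> T' \<subseteq> T \<Longrightarrow> block X T Q \<subseteq> block X T' Q'"
  by (auto simp: block_def)

lemma block_subset: "Q \<subseteq> X \<times> X \<Longrightarrow> 0 \<in> T \<Longrightarrow> block X T Q \<subseteq> Q"
  unfolding block_def by force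

lemma equiv_Int: "equiv A Q \<Longrightarrow> equiv A R \<Longrightarrow> equiv A (Q \<inter> R)"
  unfolding equiv_def refl_on_def by (auto intro: sym_Int trans_Int)

lemma equiv_ker: "equiv (snd (msrc m)) (ker m)"
  by (rule equivI) (auto simp: ker_def refl_on_def sym_def trans_def)

locale markov_base =
  fixes S :: "'g::group_add set" and b :: "'g obj"
  assumes finite_S: "finite S" and zero_S: "0 \<in> S" and gen_S: "generates_group S"
    and b_Obj: "b \<in> Obj S"
begin

abbreviation X :: "('g \<Rightarrow> nat) set" where "X \<equiv> snd b"

definition vertices :: "'g mor set" where "vertices = {m. is_mor S m \<and> msrc m = b}"

lemma vertexD: assumes "m \<in> vertices" shows "is_mor S m" "msrc m = b"
  using assms by (auto simp: vertices_def)

lemma X_shift: "x \<in> X \<Longrightarrow> shift g x \<in> X"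
  using b_Obj Obj_shift by blast

lemma equiv_block: "equiv X Q \<Longrightarrow> equiv X (block X T Q)"
proof -
  assume Q: "equiv X Q"
  show "equiv X (block X T Q)"
  proof (rule equivI)
    show "refl_on X (block X T Q)"
      using Q by (auto simp: block_def equiv_def refl_on_def X_shift)
    show "sym (block X T Q)"
      using Q by (auto simp: block_def equiv_def intro!: symI dest: symD)
    show "trans (block X T Q)"
    proof (rule transI)
      fix x y z assume "(x, y) \<in> block X T Q" "(y, z) \<in> block X T Q"
      then show "(x, z) \<in> block X T Q" using Q unfolding block_def equiv_def by (blast dest: transD)
    qed
  qed (auto simp: block_def)
qed

lemma equiv_ker_vertex: "m \<in> vertices \<Longrightarrow> equiv X (ker m)"
  using equiv_ker[of m] by (simp add: vertexD)

lemma mfun_shift: "m \<in> vertices \<Longrightarrow> x \<in> X \<Longrightarrow> mfun m (shift (- g) x) h = mfun m x (g + h)"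
  using is_morD(5)[of S m x "- g"] by (simp add: vertexD shift_apply)

lemma block_ker: "m \<in> vertices \<Longrightarrow> block X T (ker m) = {(x, y) \<in> X \<times> X. \<forall>t\<in>T. mfun m x t = mfun m y t}"
  by (auto simp: block_def ker_def vertexD X_shift mfun_shift)

lemma block_block: "block X B (block X A Q) = block X {c + a | c a. c \<in> B \<and> a \<in> A} Q"
  by (fastforce simp: block_def X_shift shift_shift minus_add)

section \<open>Realizing an equivalence relation as the kernel of a vertex\<close>

lemma finite_labelling:
  assumes m: "m \<in> vertices" and L: "equiv X L" and T: "finite T" "block X T (ker m) \<subseteq> L"
  shows "\<exists>(N::nat) lab. 1 \<le> N \<and> (\<forall>x. lab x \<in> {1..N}) \<and>
    (\<forall>x\<in>X. \<forall>y\<in>X. lab x = lab y \<longleftrightarrow> (x, y) \<in> L)"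
proof -
  \<comment> \<open>An L-class is determined by the pattern of \<open>mfun m x\<close> on the finite
    set T, and over a finite alphabet there are finitely many such patterns. The map \<rho> below
    sends a pattern to its class.\<close>
  let ?D = "(\<lambda>x. restrict (mfun m x) T) ` X"
  have "?D \<subseteq> T \<rightarrow>\<^sub>E {1..fst (mtgt m)}"
    using mfun_in[OF vertexD(1)[OF m]] Obj_subset[OF is_morD(2)[OF vertexD(1)[OF m]]] vertexD(2)[OF m]
    by (fastforce simp: full_shift_def)
  moreover have "finite (T \<rightarrow>\<^sub>E {1..fst (mtgt m)})" using T by (simp add: finite_PiE)
  ultimately have "finite ?D" by (rule finite_subset)
  moreover have "\<exists>\<rho>. X // L \<subseteq> \<rho> ` ?D"
  proof -
    define \<rho> where "\<rho> p = L `` {SOME x. x \<in> X \<and> restrict (mfun m x) T = p}" for p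
    have "L `` {x} = \<rho> (restrict (mfun m x) T)" if x: "x \<in> X" for x
    proof -
      obtain y where y: "y = (SOME y. y \<in> X \<and> restrict (mfun m y) T = restrict (mfun m x) T)"
        "y \<in> X" "restrict (mfun m y) T = restrict (mfun m x) T"
        using someI[of "\<lambda>y. y \<in> X \<and> restrict (mfun m y) T = restrict (mfun m x) T" x] x by auto
      have "mfun m x t = mfun m y t" if "t \<in> T" for t
        using fun_cong[OF y(3), of t] that by simp
      then have "(x, y) \<in> L" using T(2) x y(2) block_ker[OF m] by blast
      then show ?thesis unfolding \<rho>_def y(1)[symmetric] by (rule equiv_class_eq[OF L])
    qed
    then show ?thesis by (intro exI[of _ \<rho>]) (auto simp: quotient_def)
  qed
  ultimately have fin: "finite (X // L)" by (meson finite_imageI finite_subset)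
  then obtain h where h: "bij_betw h (X // L) {1..card (X // L)}"
    using ex_bij_betw_nat_finite_1 bij_betw_inv by blast
  \<comment> \<open>Points outside X get the label 1. Below, the alphabet size is the successor of
    the number of classes, so that it is at least 1 even if X is empty.\<close>
  define lab where "lab x = (if x \<in> X then h (L `` {x}) else 1)" for x
  show ?thesis
  proof (intro exI[of _ "Suc (card (X // L))"] exI[of _ lab] conjI ballI allI)
    show "1 \<le> Suc (card (X // L))" by simp
    show "lab x \<in> {1..Suc (card (X // L))}" for x
      using bij_betwE[OF h] quotientI[of x X L] by (fastforce simp: lab_def)
    show "lab x = lab y \<longleftrightarrow> (x, y) \<in> L" if "x \<in> X" "y \<in> X" for x y
    proof -
      have "lab x = lab y \<longleftrightarrow> L `` {x} = L `` {y}"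
        using inj_onD[OF bij_betw_imp_inj_on[OF h]] quotientI[of x X L] quotientI[of y X L] that
        by (auto simp: lab_def)
      then show ?thesis using eq_equiv_class_iff[OF L] that by blast
    qed
  qed
qed

text \<open>Labelling points by their L-class gives an equivariant embedding, and the allowed S-patterns are taken
  to be all those that occur. A configuration with only allowed patterns is glued from points \<open>\<xi> g\<close>;
  as L refines the partition of m, it determines a point x of the shift, and \<open>glue\<close> says that the
  configuration is the one coded by x.\<close>

lemma vertex_with_kernel:
  assumes m: "m \<in> vertices" and L: "equiv X L" "L \<subseteq> ker m" and T: "finite T" "block X T (ker m) \<subseteq> L"
    and glue: "\<And>x \<xi> g. x \<in> X \<Longrightarrow> (\<And>g. \<xi> g \<in> X) \<Longrightarrow>
      (\<And>g s. s \<in> S \<Longrightarrow> (shift (- s) (\<xi> g), \<xi> (g + s)) \<in> L) \<Longrightarrow>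
      (\<And>g s. s \<in> S \<Longrightarrow> mfun m (shift (- g) x) s = mfun m (\<xi> g) s) \<Longrightarrow> (shift (- g) x, \<xi> g) \<in> L"
  obtains n where "n \<in> vertices" "ker n = L"
proof -
  note mm = vertexD(1)[OF m] and ms = vertexD(2)[OF m]
  obtain k Y where kY: "mtgt m = (k, Y)" by (cases "mtgt m")
  obtain N :: nat and lab where N_lab: "1 \<le> N \<and> (\<forall>x. lab x \<in> {1..N}) \<and>
      (\<forall>x\<in>X. \<forall>y\<in>X. lab x = lab y \<longleftrightarrow> (x, y) \<in> L)"
    using finite_labelling[OF m L(1) T] by blast
  then have N: "1 \<le> N" and labN: "\<And>x. lab x \<in> {1..N}"
    and lab: "\<And>x y. x \<in> X \<Longrightarrow> y \<in> X \<Longrightarrow> lab x = lab y \<longleftrightarrow> (x, y) \<in> L"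
    by simp_all
  \<comment> \<open>The coding map: coordinate g records the L-class of the point translated by -
    g.\<close>
  define c where "c x = (\<lambda>g. lab (shift (- g) x))" for x
  define R where "R = (\<lambda>x. restrict (c x) S) ` X"
  have c_shift: "c (shift g x) = shift g (c x)" for g x
    by (simp add: c_def shift_shift fun_eq_iff shift_def[of _ "\<lambda>g. lab (shift (- g) x)"] minus_add)
  have c_full: "c x \<in> full_shift N" for x using labN by (auto simp: full_shift_def c_def)
  \<comment> \<open>Since L refines \<open>ker m\<close>, the labels determine the symbol of
    \<open>mfun m x\<close> at every coordinate, and m is injective.\<close>
  have inj: "inj_on c X"
  proof (rule inj_onI)
    fix x y assume x: "x \<in> X" and y: "y \<in> X" and eq: "c x = c y"
    have "mfun m x g = mfun m y g" for g
    proof -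
      have "(shift (- g) x, shift (- g) y) \<in> L"
        using fun_cong[OF eq, of g] lab x y X_shift by (simp add: c_def)
      then have "mfun m (shift (- g) x) 0 = mfun m (shift (- g) y) 0" using L(2) by (auto simp: ker_def)
      then show ?thesis using mfun_shift[OF m] x y by simp
    qed
    then have "mfun m x = mfun m y" by blast
    then show "x = y" using inj_onD[OF bij_betw_imp_inj_on[OF is_morD(6)[OF mm]]] x y ms by simp
  qed
  have img: "c ` X = markov_of S N R"
  proof
    show "c ` X \<subseteq> markov_of S N R"
      using c_full X_shift by (auto simp: markov_of_def R_def c_shift[symmetric])
    show "markov_of S N R \<subseteq> c ` X"
    proof
      fix z assume z: "z \<in> markov_of S N R"
      \<comment> \<open>Each S-window of z is an allowed pattern and hence occurs in the code of
        some point; this point becomes \<xi> g.\<close>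
      have "\<exists>x\<in>X. \<forall>s\<in>S. z (g + s) = c x s" for g
      proof -
        have "restrict (shift (- g) z) S \<in> R" using z by (auto simp: markov_of_def)
        then obtain x where x: "x \<in> X" "restrict (shift (- g) z) S = restrict (c x) S"
          by (auto simp: R_def)
        have "z (g + s) = c x s" if "s \<in> S" for s
          using fun_cong[OF x(2), of s] that by (simp add: shift_apply)
        then show ?thesis using x(1) by blast
      qed
      then obtain \<xi> where \<xi>: "\<And>g. \<xi> g \<in> X" "\<And>g s. s \<in> S \<Longrightarrow> z (g + s) = c (\<xi> g) s" by metis
      have z_lab: "z g = lab (\<xi> g)" for g using \<xi>(2)[OF zero_S, of g] by (simp add: c_def)
      have \<xi>L: "(shift (- s) (\<xi> g), \<xi> (g + s)) \<in> L" if "s \<in> S" for g s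
        using \<xi>(2)[OF that, of g] z_lab[of "g + s"] lab[OF X_shift[OF \<xi>(1)] \<xi>(1), of "- s" g "g + s"]
        by (simp add: c_def)
      \<comment> \<open>This decodes z through m. As the points \<xi> g are compatible modulo L, y
        coincides with the translate of \<open>mfun m (\<xi> g)\<close> on the S-window at g. Hence
        all S-patterns of y are allowed in Y, and surjectivity of m yields x.\<close>
      define y where "y g = mfun m (\<xi> g) 0" for g
      have y: "y (g + s) = mfun m (\<xi> g) s" if "s \<in> S" for g s
        using \<xi>L[OF that, of g] L(2) mfun_shift[OF m \<xi>(1), of s g 0] by (auto simp: y_def ker_def)
      have "y \<in> Y"
      proof -
        obtain R' where R': "Y = markov_of S k R'"
          using is_morD(2)[OF mm] kY by (auto simp: Obj_def is_markov_shift_def)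
        have \<xi>Y: "mfun m (\<xi> g) \<in> Y" for g using mfun_in[OF mm] \<xi>(1) ms kY by simp
        have "restrict (shift g y) S \<in> R'" for g
        proof -
          have "restrict (shift g y) S = restrict (shift 0 (mfun m (\<xi> (- g)))) S"
            using y[of _ "- g"] by (auto simp: shift_def restrict_def)
          moreover have "restrict (shift 0 (mfun m (\<xi> (- g)))) S \<in> R'"
            using \<xi>Y[of "- g"] unfolding R' markov_of_def by blast
          ultimately show ?thesis by simp
        qed
        moreover have "y g \<in> {1..k}" for g
          using \<xi>Y[of g] unfolding R' markov_of_def full_shift_def y_def by blast
        ultimately show ?thesis unfolding R' markov_of_def full_shift_def by blast
      qed
      then obtain x where x: "x \<in> X" "y = mfun m x"
        using mfun_surj[OF mm, of y] ms kY by auto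
      have "(shift (- g) x, \<xi> g) \<in> L" for g
      proof (rule glue[OF x(1) \<xi>(1) \<xi>L])
        show "mfun m (shift (- g) x) s = mfun m (\<xi> g) s" if "s \<in> S" for g s
          using mfun_shift[OF m x(1)] y[OF that] x(2) by simp
      qed auto
      then have "c x = z" using lab \<xi>(1) x(1) X_shift z_lab by (fastforce simp: c_def)
      then show "z \<in> c ` X" using x by blast
    qed
  qed
  let ?B = "(N, c ` X)"
  have "R \<subseteq> S \<rightarrow>\<^sub>E {1..N}" using c_full by (auto simp: R_def full_shift_def)
  then have B: "?B \<in> Obj S"
    using N img by (auto simp: Obj_def is_markov_shift_def)
  have cont: "continuous_map (obj_top b) (discrete_topology {1..N}) (\<lambda>x. c x g)" for g
    unfolding continuous_map_def
  proof (intro conjI allI impI)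
    show "(\<lambda>x. c x g) \<in> topspace (obj_top b) \<rightarrow> topspace (discrete_topology {1..N})"
      using labN by (auto simp: c_def)
    fix U assume "openin (discrete_topology {1..N}) U"
    \<comment> \<open>The class of \<open>shift (- g) x\<close> depends only on the symbols of
      \<open>mfun m x\<close> on g + T, so the set to be shown open is the preimage under m of a set
      determined by finitely many coordinates.\<close>
    let ?W = "{y \<in> full_shift k. \<exists>x\<in>X. c x g \<in> U \<and> (\<forall>t\<in>T. y (g + t) = mfun m x (g + t))}"
    have W: "openin (conf_top k) ?W"
    proof (rule openin_conf_top_local[of "(+) g ` T"])
      fix x y assume x: "x \<in> ?W" and y: "y \<in> full_shift k"
        and "\<And>t. t \<in> (+) g ` T \<Longrightarrow> x t = y t"
      then have "y (g + t) = x (g + t)" if "t \<in> T" for t using that by auto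
      then show "y \<in> ?W" using x y by auto
    qed (use T in auto)
    have "continuous_map (obj_top b) (conf_top k) (mfun m)"
      using homeomorphic_imp_continuous_map[OF is_morD(4)[OF mm]] ms kY
      by (simp add: obj_top_def[of "(k, Y)"] continuous_map_in_subtopology)
    then have "openin (obj_top b) {x \<in> topspace (obj_top b). mfun m x \<in> ?W}"
      using W openin_continuous_map_preimage by blast
    moreover have "mfun m x \<in> ?W \<longleftrightarrow> c x g \<in> U" if x: "x \<in> X" for x
    proof
      assume "mfun m x \<in> ?W"
      then obtain x' where x': "x' \<in> X" "c x' g \<in> U" "\<forall>t\<in>T. mfun m x (g + t) = mfun m x' (g + t)"
        by blast
      then have "(shift (- g) x, shift (- g) x') \<in> block X T (ker m)"
        using x X_shift mfun_shift[OF m] unfolding block_ker[OF m] by simp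
      then have "c x g = c x' g" using T(2) lab x x'(1) X_shift by (auto simp: c_def)
      then show "c x g \<in> U" using x' by simp
    next
      assume "c x g \<in> U"
      moreover have "mfun m x \<in> full_shift k"
        using mfun_in[OF mm, of x] x ms kY Obj_subset[OF is_morD(2)[OF mm]] by auto
      ultimately show "mfun m x \<in> ?W" using x by blast
    qed
    ultimately show "openin (obj_top b) {x \<in> topspace (obj_top b). c x g \<in> U}"
      using b_Obj by (simp cong: conj_cong)
  qed
  define n where "n = (b, ?B, restrict c X)"
  have "continuous_map (obj_top b) (obj_top ?B) c"
    using cont b_Obj unfolding obj_top_def[of ?B] conf_top_def
    by (auto simp: continuous_map_in_subtopology continuous_map_componentwise_UNIV)
  \<comment> \<open>A continuous bijection from a compact space to a Hausdorff space has a
    continuous inverse.\<close>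
  then have "homeomorphic_map (obj_top b) (obj_top ?B) c"
    using compact_obj_top[OF b_Obj finite_S] Hausdorff_obj_top inj b_Obj B
    by (intro continuous_imp_homeomorphic_map) auto
  then have "homeomorphic_map (obj_top b) (obj_top ?B) (restrict c X)"
    by (rule homeomorphic_map_eq) (use b_Obj in simp)
  then have "is_mor S n"
    using b_Obj B X_shift by (simp add: is_mor_def n_def msrc_def mtgt_def mfun_def c_shift)
  then have "n \<in> vertices" by (simp add: vertices_def n_def msrc_def)
  moreover have "ker n = L"
    using lab equiv_type[OF L(1)] by (auto simp: ker_def n_def msrc_def mfun_def c_def)
  ultimately show ?thesis using that by blast
qed

text \<open>Agreement of the m-symbols on S already puts two points into the S-block refinement of
  \<open>ker m\<close>, which lies inside L; this is the gluing condition.\<close>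

lemma vertex_forward:
  assumes m: "m \<in> vertices" and L: "equiv X L" "block X S (ker m) \<subseteq> L" "L \<subseteq> ker m"
  shows "\<exists>n\<in>vertices. ker n = L"
proof -
  obtain n where "n \<in> vertices" "ker n = L"
  proof (rule vertex_with_kernel[OF m L(1,3) finite_S L(2)])
    fix x g and \<xi> :: "'g \<Rightarrow> 'g \<Rightarrow> nat"
    assume "x \<in> X" "\<And>g. \<xi> g \<in> X" "\<And>g s. s \<in> S \<Longrightarrow> mfun m (shift (- g) x) s = mfun m (\<xi> g) s"
    then have "(shift (- g) x, \<xi> g) \<in> block X S (ker m)"
      unfolding block_ker[OF m] using X_shift by simp
    then show "(shift (- g) x, \<xi> g) \<in> L" using L(2) by blast
  qed
  then show ?thesis by blast
qed

text \<open>To glue, look back from g to g - s. There the translate of x and \<xi> (g - s) are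
  equivalent modulo \<open>ker m\<close>, hence modulo Q, and the compatibility of \<xi> between g -
  s and g relates \<xi> (g - s) to the translate of \<xi> g by s; transitivity of Q
  concludes.\<close>

lemma vertex_backward:
  assumes m: "m \<in> vertices" and Q: "equiv X Q" "ker m \<subseteq> Q"
  shows "\<exists>n\<in>vertices. ker n = ker m \<inter> block X (uminus ` S) Q"
proof -
  let ?L = "ker m \<inter> block X (uminus ` S) Q"
  have L: "equiv X ?L"
    using equiv_ker_vertex[OF m] equiv_block[OF Q(1)]
    by (simp add: equiv_Int)
  have 0: "0 \<in> uminus ` S" using zero_S by force
  have "block X (uminus ` S) (ker m) \<subseteq> ?L"
    using block_mono[OF Q(2) subset_refl] block_subset[OF equiv_type[OF equiv_ker_vertex[OF m]] 0] by blast
  moreover have "(shift (- g) x, \<xi> g) \<in> ?L"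
    if x: "x \<in> X" and \<xi>: "\<And>g. \<xi> g \<in> X"
      and sL: "\<And>g s. s \<in> S \<Longrightarrow> (shift (- s) (\<xi> g), \<xi> (g + s)) \<in> ?L"
      and sm: "\<And>g s. s \<in> S \<Longrightarrow> mfun m (shift (- g) x) s = mfun m (\<xi> g) s" for x g \<xi>
  proof -
    have K: "(shift (- g) x, \<xi> g) \<in> ker m" for g
      using sm[OF zero_S] x \<xi> X_shift vertexD(2)[OF m] by (simp add: ker_def)
    have "(shift s (shift (- g) x), shift s (\<xi> g)) \<in> Q" if s: "s \<in> S" for s
    proof -
      have 1: "(shift (- (g - s)) x, \<xi> (g - s)) \<in> Q" using K Q(2) by blast
      have "(shift (- s) (\<xi> (g - s)), \<xi> g) \<in> block X (uminus ` S) Q" using sL[OF s, of "g - s"] by simp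
      then have "(shift s (shift (- s) (\<xi> (g - s))), shift s (\<xi> g)) \<in> Q"
        using s by (auto simp: block_def)
      then have "(\<xi> (g - s), shift s (\<xi> g)) \<in> Q" by (simp add: shift_shift)
      moreover have "shift s (shift (- g) x) = shift (- (g - s)) x"
        by (simp add: shift_shift)
      ultimately show ?thesis using 1 Q(1) by (metis equivE transD)
    qed
    then show ?thesis using K x \<xi> X_shift by (auto simp: block_def)
  qed
  ultimately obtain n where "n \<in> vertices" "ker n = ?L"
    using vertex_with_kernel[OF m L _ finite_imageI[OF finite_S]] by blast
  then show ?thesis by blast
qed

subsection \<open>Refinement along words\<close>

definition dir :: "bool \<Rightarrow> 'g set" where "dir d = (if d then S else uminus ` S)"

primrec block_word :: "bool list \<Rightarrow> (('g \<Rightarrow> nat) \<times> ('g \<Rightarrow> nat)) set \<Rightarrow> (('g \<Rightarrow> nat) \<times> ('g \<Rightarrow> nat)) set" where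
  "block_word [] Q = Q"
| "block_word (d # w) Q = block_word w (block X (dir d) Q)"

lemma zero_dir: "0 \<in> dir d"
  using zero_S by (force simp: dir_def)

lemma block_word_mono: "Q \<subseteq> Q' \<Longrightarrow> block_word w Q \<subseteq> block_word w Q'"
  by (induction w arbitrary: Q Q') (auto simp: block_mono)

lemma block_type: "block X T Q \<subseteq> X \<times> X"
  by (auto simp: block_def)

lemma block_word_subset: "Q \<subseteq> X \<times> X \<Longrightarrow> block_word w Q \<subseteq> Q"
proof (induction w arbitrary: Q)
  case (Cons d w)
  have "block_word w (block X (dir d) Q) \<subseteq> block X (dir d) Q" by (rule Cons.IH[OF block_type])
  then show ?case using block_subset[OF Cons.prems zero_dir] by simp blast
qed simp

lemma block_word_append: "block_word (v @ w) Q = block_word w (block_word v Q)"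
  by (induction v arbitrary: Q) auto

text \<open>Refinement along a word shrinks relations and is monotone, so a concatenation refines at
  least as far as each of its factors.\<close>

lemma common_word:
  assumes "finite I" "Q \<subseteq> X \<times> X" "\<And>i. i \<in> I \<Longrightarrow> \<exists>w. block_word w Q \<subseteq> A i"
  shows "\<exists>w. \<forall>i\<in>I. block_word w Q \<subseteq> A i"
  using assms(1,3)
proof (induction I)
  case (insert i I)
  obtain v where v: "\<forall>i\<in>I. block_word v Q \<subseteq> A i" using insert by auto
  obtain w where w: "block_word w Q \<subseteq> A i" using insert.prems by blast
  have "block_word (v @ w) Q \<subseteq> block_word v Q"
    using block_word_subset[of "block_word v Q" w] block_word_subset[OF assms(2), of v] assms(2)
    by (auto simp: block_word_append)
  moreover have "block_word (v @ w) Q \<subseteq> block_word w Q"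
    using block_word_mono[OF block_word_subset[OF assms(2)]] by (simp add: block_word_append)
  ultimately show ?case using v w by blast
qed simp

text \<open>The elements reached by words form a subgroup containing S. The word must serve all Q at
  once, since a sum is reached by applying the word of one summand to the block refinement by the
  other.\<close>

lemma word_reaches:
  "\<exists>w. \<forall>Q. Q \<subseteq> X \<times> X \<longrightarrow> block_word w Q \<subseteq> block X {g} Q"
proof -
  define reach where "reach g \<longleftrightarrow> (\<exists>w. \<forall>Q. Q \<subseteq> X \<times> X \<longrightarrow> block_word w Q \<subseteq> block X {g} Q)" for g
  have add: "reach (a + c)" if ac: "reach a" "reach c" for a c
  proof -
    obtain w where w: "\<And>Q. Q \<subseteq> X \<times> X \<Longrightarrow> block_word w Q \<subseteq> block X {a} Q"
      using ac(1) by (auto simp: reach_def)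
    obtain v where v: "\<And>Q. Q \<subseteq> X \<times> X \<Longrightarrow> block_word v Q \<subseteq> block X {c} Q"
      using ac(2) by (auto simp: reach_def)
    have "block_word (v @ w) Q \<subseteq> block X {a + c} Q" if Q: "Q \<subseteq> X \<times> X" for Q
    proof -
      have "block_word (v @ w) Q \<subseteq> block_word w (block X {c} Q)"
        using block_word_mono[OF v[OF Q]] by (simp add: block_word_append)
      also have "\<dots> \<subseteq> block X {a} (block X {c} Q)" by (rule w[OF block_type])
      also have "\<dots> = block X {a + c} Q" by (simp add: block_block)
      finally show ?thesis .
    qed
    then show ?thesis unfolding reach_def by blast
  qed
  have step: "reach g" if "g \<in> dir d" for g d
    unfolding reach_def using that block_mono[of _ _ "{g}" "dir d" X]
    by (intro exI[of _ "[d]"]) auto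
  \<comment> \<open>Carrying - g along in the induction makes closure under negation
    immediate.\<close>
  have "g \<in> gen_subgroup S \<Longrightarrow> reach g \<and> reach (- g)" for g
  proof (induction rule: gen_subgroup.induct)
    case gen_zero
    then show ?case using step zero_dir by simp
  next
    case (gen_base s)
    then show ?case using step[of s True] step[of "- s" False] by (simp add: dir_def)
  next
    case (gen_add a c)
    then show ?case using add[of a c] add[of "- c" "- a"] by (simp add: minus_add)
  qed simp_all
  then show ?thesis using gen_S by (auto simp: generates_group_def reach_def)
qed

text \<open>The transition from m to n is continuous, so its symbol at 0 depends on a finite window
  T; a word that reaches every element of T suffices.\<close>

lemma word_refines:
  assumes m: "m \<in> vertices" and n: "n \<in> vertices"
  shows "\<exists>w. block_word w (ker m) \<subseteq> ker n"
proof -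
  note mm = vertexD(1)[OF m] and nm = vertexD(1)[OF n]
  let ?e = "mcomp n (minv m)"
  have e: "is_mor S ?e" using is_mor_mcomp[OF is_mor_minv[OF mm] nm] vertexD m n by simp
  obtain k Y where kY: "mtgt n = (k, Y)" by (cases "mtgt n")
  have "continuous_map (obj_top (mtgt m)) (obj_top (mtgt n)) (mfun ?e)"
    using homeomorphic_imp_continuous_map[OF is_morD(4)[OF e]] by simp
  then have "continuous_map (obj_top (mtgt m)) (conf_top k) (mfun ?e)"
    by (simp add: kY obj_top_def[of "(k, Y)"] continuous_map_in_subtopology)
  then have cont: "continuous_map (obj_top (mtgt m)) (discrete_topology {1..k}) (\<lambda>y. mfun ?e y 0)"
    unfolding conf_top_def continuous_map_componentwise_UNIV by blast
  then obtain T where T: "finite T"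
    "\<And>x y. x \<in> snd (mtgt m) \<Longrightarrow> y \<in> snd (mtgt m) \<Longrightarrow> (\<And>t. t \<in> T \<Longrightarrow> x t = y t) \<Longrightarrow>
      mfun ?e x 0 = mfun ?e y 0"
    using continuous_discrete_imp_local[OF is_morD(2)[OF mm] finite_S cont] by blast
  have K: "ker m \<subseteq> X \<times> X" using equiv_type[OF equiv_ker_vertex[OF m]] .
  obtain w where w: "\<forall>t\<in>T. block_word w (ker m) \<subseteq> block X {t} (ker m)"
    using common_word[OF T(1) K, of "\<lambda>t. block X {t} (ker m)"] word_reaches K by metis
  have "block_word w (ker m) \<subseteq> ker n"
  proof (rule subrelI)
    fix x y assume xy: "(x, y) \<in> block_word w (ker m)"
    then have X: "x \<in> X" "y \<in> X" using block_word_subset[OF K] K by auto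
    have "mfun m x t = mfun m y t" if "t \<in> T" for t
      using xy w that unfolding block_ker[OF m] by auto
    then have "mfun ?e (mfun m x) 0 = mfun ?e (mfun m y) 0"
      using T(2) mfun_in[OF mm] X vertexD(2)[OF m] by simp
    then show "(x, y) \<in> ker n"
      using X mfun_in[OF mm] mfun_minv_mfun[OF mm] vertexD(2)[OF m] vertexD(2)[OF n]
      by (simp add: mfun_mcomp ker_def)
  qed
  then show ?thesis by blast
qed

end

subsection \<open>Contractibility of the complex of partitions\<close>

lemma block_Int: "block X T (Q \<inter> R) = block X T Q \<inter> block X T R"
  by (auto simp: block_def)

context markov_base
begin

definition edge :: "'g mor \<Rightarrow> 'g mor \<Rightarrow> bool" where
  "edge m n \<longleftrightarrow> m \<in> vertices \<and> n \<in> vertices \<and> block X S (ker m) \<subseteq> ker n \<and> block X (uminus ` S) (ker n) \<subseteq> ker m"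

lemma ker_type: "m \<in> vertices \<Longrightarrow> ker m \<subseteq> X \<times> X"
  using equiv_type equiv_ker_vertex by blast

lemma block_dir_subset: "Q \<subseteq> X \<times> X \<Longrightarrow> block X (dir d) Q \<subseteq> Q"
  using block_subset zero_dir by blast

lemma block_forward_subset: "Q \<subseteq> X \<times> X \<Longrightarrow> block X S Q \<subseteq> Q"
  and block_backward_subset: "Q \<subseteq> X \<times> X \<Longrightarrow> block X (uminus ` S) Q \<subseteq> Q"
  using block_dir_subset[of Q True] block_dir_subset[of Q False] by (simp_all add: dir_def)

lemma edge_same_kernel: "m \<in> vertices \<Longrightarrow> n \<in> vertices \<Longrightarrow> ker m = ker n \<Longrightarrow> edge m n"
  using block_forward_subset block_backward_subset ker_type unfolding edge_def by metis

lemma refinement_exists: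
  assumes m: "m \<in> vertices" and Q: "equiv X Q" "ker m \<subseteq> Q"
  shows "\<exists>n\<in>vertices. ker n = ker m \<inter> block X (dir d) Q"
proof (cases d)
  case True
  have "equiv X (ker m \<inter> block X S Q)"
    using equiv_Int equiv_ker_vertex[OF m] equiv_block[OF Q(1)] by blast
  moreover have "block X S (ker m) \<subseteq> ker m \<inter> block X S Q"
    using block_forward_subset[OF ker_type[OF m]] block_mono[OF Q(2) subset_refl] by blast
  ultimately show ?thesis using vertex_forward[OF m] True by (simp add: dir_def)
next
  case False
  then show ?thesis using vertex_backward[OF m Q] by (simp add: dir_def)
qed

text \<open>Refining by S gives edges from old to new vertices, refining by S^{-1} edges from new to
  old. In both cases one diagonal is an edge as well and cuts the square into two triangles.\<close>

lemma refinement_edges: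
  assumes mn: "edge m n" and Q: "Q \<subseteq> X \<times> X" "ker m \<subseteq> Q" "ker n \<subseteq> Q"
    and m': "m' \<in> vertices" "ker m' = ker m \<inter> block X (dir d) Q"
    and n': "n' \<in> vertices" "ker n' = ker n \<inter> block X (dir d) Q"
  shows "d \<Longrightarrow> edge m m' \<and> edge n n' \<and> edge m n' \<and> edge m' n'"
    and "\<not> d \<Longrightarrow> edge m' m \<and> edge n' n \<and> edge m' n \<and> edge m' n'"
proof -
  have vertices: "m \<in> vertices" "n \<in> vertices" using mn by (auto simp: edge_def)
  note K = ker_type[OF vertices(1)] ker_type[OF vertices(2)]
  note facts = block_mono[OF Q(2) subset_refl, of X S] block_mono[OF Q(3) subset_refl, of X S]
    block_mono[OF Q(2) subset_refl, of X "uminus ` S"] block_mono[OF Q(3) subset_refl, of X "uminus ` S"]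
    block_forward_subset[OF K(1)] block_forward_subset[OF K(2)]
    block_backward_subset[OF K(1)] block_backward_subset[OF K(2)]
    block_forward_subset[OF block_type, of "uminus ` S" Q] block_backward_subset[OF block_type, of S Q]
  have mn': "block X S (ker m) \<subseteq> ker n" "block X (uminus ` S) (ker n) \<subseteq> ker m"
    using mn by (auto simp: edge_def)
  show "edge m m' \<and> edge n n' \<and> edge m n' \<and> edge m' n'" if d
    using that vertices m'(1) n'(1) facts mn' unfolding edge_def m'(2) n'(2) block_Int
    by (simp add: dir_def) blast
  show "edge m' m \<and> edge n' n \<and> edge m' n \<and> edge m' n'" if "\<not> d"
    using that vertices m'(1) n'(1) facts mn' unfolding edge_def m'(2) n'(2) block_Int
    by (simp add: dir_def) blast
qed

text \<open>The edge between m and n may point either way and d orients the rungs. In each of the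
  four cases the available diagonal decides between \<open>square\<close> and
  \<open>square'\<close>.\<close>

lemma refinement_square:
  assumes mn: "adj edge m n" and Q: "Q \<subseteq> X \<times> X" "ker m \<subseteq> Q" "ker n \<subseteq> Q"
    and m': "m' \<in> vertices" "ker m' = ker m \<inter> block X (dir d) Q"
    and n': "n' \<in> vertices" "ker n' = ker n \<inter> block X (dir d) Q"
  shows "path_hom edge [m, n, n'] [m, m', n']" "adj edge m m'" "adj edge m' n'"
proof -
  note edges = refinement_edges[OF _ Q m' n'] refinement_edges[OF _ Q(1,3,2) n' m']
  have "path_hom edge [m, n, n'] [m, m', n'] \<and> adj edge m m' \<and> adj edge m' n'"
  proof (cases "edge m n")
    case mn: True
    show ?thesis
    proof (cases d)
      case True
      then have e: "edge m m'" "edge n n'" "edge m n'" "edge m' n'" using edges(1)[OF mn] by auto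
      have "path_hom edge [m, n, n'] [m, m', n']"
        by (rule square) (use triangle(1)[OF mn e(2,3)] triangle(1)[OF e(1,4,3)] in auto)
      then show ?thesis using e by blast
    next
      case False
      then have e: "edge m' m" "edge n' n" "edge m' n" "edge m' n'" using edges(2)[OF mn] by auto
      have "path_hom edge [m, n, n'] [m, m', n']"
        by (rule square') (use triangle(4)[OF e(1) mn e(3)] triangle(5)[OF e(4,2,3)] in auto)
      then show ?thesis using e by blast
    qed
  next
    case False
    then have nm: "edge n m" using mn by blast
    show ?thesis
    proof (cases d)
      case True
      then have e: "edge m m'" "edge n n'" "edge n m'" "edge n' m'" using edges(3)[OF nm] by auto
      have "path_hom edge [m, n, m'] [m, m']" "path_hom edge [n, m', n'] [n, n']"
        using triangle(2)[OF nm e(1,3)] triangle(3)[OF e(2,4,3)] .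
      then have "path_hom edge [m, n, n'] [m, m', n']" by (rule square')
      then show ?thesis using e by blast
    next
      case False
      then have e: "edge m' m" "edge n' n" "edge n' m" "edge n' m'" using edges(4)[OF nm] by auto
      have "path_hom edge [m, n, n'] [m, n']" "path_hom edge [m, m', n'] [m, n']"
        using triangle(6)[OF e(2) nm e(3)] triangle(6)[OF e(4,1,3)] .
      then have "path_hom edge [m, n, n'] [m, m', n']" by (rule square)
      then show ?thesis using e by blast
    qed
  qed
  then show "path_hom edge [m, n, n'] [m, m', n']" "adj edge m m'" "adj edge m' n'" by auto
qed

text \<open>Induction on the word that squeezes all kernels between \<open>block_word w Q\<close>
  and Q. One letter replaces Q by its block refinement and both paths by their images under the
  refinement homotopy; for the empty word all kernels equal Q and the vertices form a
  clique.\<close>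

lemma path_hom_between:
  assumes "equiv X Q" "epath edge x u y" "epath edge x v y"
    and "\<And>m. m \<in> set u \<union> set v \<Longrightarrow> m \<in> vertices \<and> ker m \<subseteq> Q \<and> block_word w Q \<subseteq> ker m"
  shows "path_hom edge u v"
  using assms
proof (induction w arbitrary: Q x y u v)
  case Nil
  have clique: "path_hom edge p [x, y]" if "epath edge x p y" "set p \<subseteq> set u \<union> set v" for p
  proof -
    have "path_hom edge p [hd p, last p]"
    proof (rule path_hom_clique)
      show "edge m n" if "m \<in> set p" "n \<in> set p" for m n
        using Nil.prems(4)[of m] Nil.prems(4)[of n] that \<open>set p \<subseteq> _\<close>
        by (intro edge_same_kernel) auto
    qed (use that in \<open>simp add: epath_def\<close>)
    then show ?thesis using that by (simp add: epath_def)
  qed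
  show ?case
    by (rule path_hom.hom_trans[OF clique path_hom.hom_sym[OF clique]]) (use Nil.prems in auto)
next
  case (Cons d w)
  note QX = equiv_type[OF Cons.prems(1)]
  let ?Q = "block X (dir d) Q"
  \<comment> \<open>One choice of F serves both paths, so their images again have common
    ends.\<close>
  define F where "F m = (SOME n. n \<in> vertices \<and> ker n = ker m \<inter> ?Q)" for m
  have F: "F m \<in> vertices" "ker (F m) = ker m \<inter> ?Q" if "m \<in> set u \<union> set v" for m
    using someI_ex[of "\<lambda>n. n \<in> vertices \<and> ker n = ker m \<inter> ?Q"]
      refinement_exists[OF _ Cons.prems(1), of m d] Cons.prems(4)[OF that]
    unfolding F_def by blast+
  have sq: "path_hom edge [m, n, F n] [m, F m, F n]" "adj edge m (F m)" "adj edge (F m) (F n)"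
    if "m \<in> set u \<union> set v" "n \<in> set u \<union> set v" "adj edge m n" for m n
    using refinement_square[OF that(3) QX _ _ F[OF that(1)] F[OF that(2)]]
      Cons.prems(4)[OF that(1)] Cons.prems(4)[OF that(2)] by blast+
  have self: "adj edge m (F m)" if "m \<in> set u \<union> set v" for m
    using sq(2)[OF that that] edge_same_kernel Cons.prems(4)[OF that] by blast
  have up: "path_hom edge p (x # map F p @ [y])" "epath edge (F x) (map F p) (F y)"
    if p: "epath edge x p y" "set p \<subseteq> set u \<union> set v" for p
  proof -
    have "path_hom edge p (hd p # map F p @ [last p])"
    proof (rule path_hom_map)
      show "path_hom edge [m, n, F n] [m, F m, F n]" if "m \<in> set p" "n \<in> set p" "adj edge m n" for m n
        using sq(1) that p(2) by blast
      show "adj edge m (F m)" if "m \<in> set p" for m using self that p(2) by blast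
    qed (use p in \<open>simp_all add: epath_def\<close>)
    then show "path_hom edge p (x # map F p @ [y])" using p by (simp add: epath_def)
    have "successively (adj edge) p" using p by (simp add: epath_def)
    then have "successively (\<lambda>m n. adj edge (F m) (F n)) p"
      by (rule successively_mono) (use p sq(3) in blast)
    then show "epath edge (F x) (map F p) (F y)"
      using p by (auto simp: epath_def hd_map last_map successively_map)
  qed
  have "path_hom edge (map F u) (map F v)"
  proof (rule Cons.IH)
    show "equiv X ?Q" using equiv_block Cons.prems(1) .
    fix n assume "n \<in> set (map F u) \<union> set (map F v)"
    then have "n \<in> F ` (set u \<union> set v)" by (simp add: image_Un)
    then obtain m where m: "m \<in> set u \<union> set v" "n = F m" by blast
    then show "n \<in> vertices \<and> ker n \<subseteq> ?Q \<and> block_word w ?Q \<subseteq> ker n"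
      using F[OF m(1)] Cons.prems(4)[OF m(1)] block_word_subset[OF block_type, of w "dir d" Q] by auto
  qed (use up(2) Cons.prems in auto)
  then have "path_hom edge ([x] @ map F u @ [y]) ([x] @ map F v @ [y])" by (rule path_hom_cong)
  then have mid: "path_hom edge (x # map F u @ [y]) (x # map F v @ [y])" by simp
  have "path_hom edge u (x # map F u @ [y])" by (rule up(1)[OF Cons.prems(2)]) simp
  also note mid
  also have "path_hom edge (x # map F v @ [y]) v"
    by (rule path_hom.hom_sym[OF up(1)[OF Cons.prems(3)]]) simp
  finally show ?case .
qed

section \<open>Paths among the refinements of a vertex\<close>

definition cone :: "'g mor \<Rightarrow> 'g mor list \<Rightarrow> 'g mor \<Rightarrow> bool" where
  "cone p u y \<longleftrightarrow> epath edge p u y \<and> (\<forall>n\<in>set u. n \<in> vertices \<and> ker n \<subseteq> ker p)"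

lemma common_refining_word:
  assumes "finite M" "M \<subseteq> vertices" "p \<in> vertices"
  shows "\<exists>w. \<forall>m\<in>M. block_word w (ker p) \<subseteq> ker m"
  using common_word[OF assms(1) ker_type[OF assms(3)], of ker] word_refines assms by blast

lemma cone_vertex: "cone p u y \<Longrightarrow> p \<in> vertices"
  unfolding cone_def epath_def using hd_in_set by blast

lemma cone_Cons:
  assumes "cone p u y" "adj edge x p" "x \<in> vertices" "ker p \<subseteq> ker x"
  shows "cone x (x # u) y"
proof -
  have "epath edge x (x # u) y"
    using assms(1,2) by (simp add: cone_def epath_def successively_Cons)
  moreover have "n \<in> vertices \<and> ker n \<subseteq> ker x" if "n \<in> set (x # u)" for n
    using that assms unfolding cone_def by (metis set_ConsD subset_refl subset_trans)
  ultimately show ?thesis by (simp only: cone_def) blast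
qed

text \<open>Some word refines \<open>ker p\<close> below all kernels on the two paths, which is the
  lower bound that \<open>path_hom_between\<close> asks for.\<close>

lemma cone_unique:
  assumes "cone p u y" "cone p v y"
  shows "path_hom edge u v"
proof -
  have p: "p \<in> vertices" using assms cone_vertex by blast
  obtain w where "\<forall>m \<in> set u \<union> set v. block_word w (ker p) \<subseteq> ker m"
    using common_refining_word[of "set u \<union> set v" p] p assms unfolding cone_def by blast
  then show ?thesis
    using path_hom_between[OF equiv_ker_vertex[OF p], of p u y v w] assms unfolding cone_def by blast
qed

text \<open>The relation Q that drives the refinement is kept apart from the kernel of the current
  vertex. As the successive block refinements of Q decrease, intersecting with all of them amounts
  to intersecting with the last.\<close>

lemma cone_block_word:
  assumes "m \<in> vertices" "equiv X Q" "ker m \<subseteq> Q"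
  shows "\<exists>u m'. cone m u m' \<and> m' \<in> vertices \<and> ker m' = ker m \<inter> block_word w Q"
  using assms
proof (induction w arbitrary: m Q)
  case Nil
  then have "cone m [m] m" by (simp add: cone_def epath_def)
  then show ?case using Nil by (metis block_word.simps(1) inf.absorb1)
next
  case (Cons d w)
  let ?Q = "block X (dir d) Q"
  obtain n where n: "n \<in> vertices" "ker n = ker m \<inter> ?Q" using refinement_exists[OF Cons.prems] by blast
  obtain u m' where u: "cone n u m'" "m' \<in> vertices" "ker m' = ker n \<inter> block_word w ?Q"
    using Cons.IH[OF n(1) equiv_block[OF Cons.prems(2)]] n by blast
  have "ker m' = ker m \<inter> block_word (d # w) Q"
    using u n block_word_subset[OF block_type, of w "dir d" Q] by auto
  moreover have "adj edge m n"
    using refinement_square(2)[OF _ equiv_type[OF Cons.prems(2)] Cons.prems(3,3) n n]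
      edge_same_kernel[OF Cons.prems(1,1)] by blast
  then have "cone m (m # u) m'"
    using cone_Cons[OF u(1)] n Cons.prems(1) by blast
  ultimately show ?case using u(2) by blast
qed

text \<open>Both p and y are refined along one word, driven by \<open>ker p\<close> and leading
  below \<open>ker y\<close>. The two final kernels coincide, so the final vertices are joined by an
  edge, and the walk from y is then traversed backwards.\<close>

lemma cone_exists:
  assumes "p \<in> vertices" "y \<in> vertices" "ker y \<subseteq> ker p"
  obtains u where "cone p u y"
proof -
  note Q = equiv_ker_vertex[OF assms(1)]
  obtain w where w: "block_word w (ker p) \<subseteq> ker y" using word_refines assms by blast
  obtain u p' where u: "cone p u p'" "p' \<in> vertices" "ker p' = ker p \<inter> block_word w (ker p)"
    using cone_block_word[OF assms(1) Q] by blast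
  obtain v y' where v: "cone y v y'" "y' \<in> vertices" "ker y' = ker y \<inter> block_word w (ker p)"
    using cone_block_word[OF assms(2) Q assms(3)] by blast
  have "edge p' y'"
    using edge_same_kernel[OF u(2) v(2)] u(3) v(3) w block_word_subset[OF ker_type[OF assms(1)], of w] by blast
  then have "epath edge p' [p', y'] y'" by (simp add: epath_def)
  then have "epath edge p (u @ [y']) y'"
    using epath_append[of edge p u p' "[p', y']" y'] u(1) unfolding cone_def by simp
  then have "epath edge p ((u @ [y']) @ tl (rev v)) y"
    by (rule epath_append) (use v(1) epath_rev in \<open>auto simp: cone_def\<close>)
  moreover have "\<forall>n\<in>set ((u @ [y']) @ tl (rev v)). n \<in> vertices \<and> ker n \<subseteq> ker p"
  proof
    fix n assume "n \<in> set ((u @ [y']) @ tl (rev v))"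
    moreover have "set (tl (rev v)) \<subseteq> set v" by (metis list.set_sel(2) set_rev subsetI tl_Nil)
    ultimately have "n \<in> set u \<or> n = y' \<or> n \<in> set v" by auto
    then show "n \<in> vertices \<and> ker n \<subseteq> ker p"
      using u(1) v assms(3) unfolding cone_def by blast
  qed
  ultimately show ?thesis using that cone_def by blast
qed

section \<open>Replacing a path by cones over a common refinement\<close>

lemma edge_subdivision:
  assumes "adj edge m n"
  shows "\<exists>M\<in>vertices. ker M \<subseteq> ker m \<and> ker M \<subseteq> ker n \<and> ker m \<inter> ker n \<subseteq> ker M \<and>
    adj edge m M \<and> adj edge M n \<and> path_hom edge [m, n] [m, M, n]"
proof -
  \<comment> \<open>The join of the two kernels lies between \<open>ker m\<close> and its S-block
    refinement, so it is the kernel of a vertex M, and m, M, n span an ordered triangle. Every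
    common refinement of m and n also refines M, so M has cones to it.\<close>
  have *: "\<exists>M\<in>vertices. ker M = ker m \<inter> ker n \<and> edge m M \<and> edge M n" if mn: "edge m n" for m n
  proof -
    have vertices: "m \<in> vertices" "n \<in> vertices" and e: "block X S (ker m) \<subseteq> ker n" "block X (uminus ` S) (ker n) \<subseteq> ker m"
      using mn by (auto simp: edge_def)
    note K = ker_type[OF vertices(1)] ker_type[OF vertices(2)]
    have "block X S (ker m) \<subseteq> ker m \<inter> ker n" using e block_forward_subset[OF K(1)] by blast
    then obtain M where "M \<in> vertices" "ker M = ker m \<inter> ker n"
      using vertex_forward[OF vertices(1) equiv_Int[OF equiv_ker_vertex[OF vertices(1)] equiv_ker_vertex[OF vertices(2)]]] by blast
    then show ?thesis
      using vertices e block_forward_subset[OF K(1)] block_forward_subset[OF K(2)]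
        block_backward_subset[OF K(1)] block_backward_subset[OF K(2)]
      unfolding edge_def by (intro bexI[of _ M]) (auto simp: block_Int)
  qed
  show ?thesis
  proof (cases "edge m n")
    case True
    then obtain M where "M \<in> vertices" "ker M = ker m \<inter> ker n" "edge m M" "edge M n" using * by blast
    then show ?thesis using triangle(1)[of edge m M n] True path_hom.hom_sym by blast
  next
    case False
    then have nm: "edge n m" using assms by blast
    then obtain M where "M \<in> vertices" "ker M = ker n \<inter> ker m" "edge n M" "edge M m" using * by blast
    then show ?thesis using triangle(6)[of edge n M m] nm path_hom.hom_sym by blast
  qed
qed

text \<open>Induction on u. For a first edge from x to z subdivided by M, one cone from M extends to
  cones from both x and z, and uniqueness of cones trades the cone from z for the one from
  x.\<close>

lemma path_hom_cone:
  assumes "epath edge x u y" "set u \<subseteq> vertices" "N \<in> vertices" "\<And>m. m \<in> set u \<Longrightarrow> ker N \<subseteq> ker m"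
    and "cone x c N" "cone y d N"
  shows "path_hom edge (u @ tl d) c"
  using assms
proof (induction u arbitrary: x c rule: induct_list012)
  case 1
  then show ?case by (simp add: epath_def)
next
  case (2 z)
  then have "z = x" "y = x" by (auto simp: epath_def)
  moreover have "d = y # tl d" using 2 by (cases d) (auto simp: cone_def epath_def)
  ultimately show ?case using cone_unique[OF 2(6)] 2(5) path_hom.hom_sym by fastforce
next
  case (3 a z r)
  have a: "a = x" and xz: "adj edge x z" and zr: "epath edge z (z # r) y"
    using "3.prems"(1) by (auto simp: epath_def)
  have xV: "x \<in> vertices" "z \<in> vertices" using "3.prems"(2) a by auto
  have Nz: "ker N \<subseteq> ker x" "ker N \<subseteq> ker z" using "3.prems"(4) a by auto
  obtain cz where cz: "cone z cz N" using cone_exists[OF xV(2) "3.prems"(3) Nz(2)] .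
  obtain M where M: "M \<in> vertices" "ker M \<subseteq> ker x" "ker M \<subseteq> ker z" "ker x \<inter> ker z \<subseteq> ker M"
    "adj edge x M" "adj edge M z" "path_hom edge [x, z] [x, M, z]"
    using edge_subdivision[OF xz] by blast
  obtain cM where cM: "cone M cM N"
    using cone_exists[OF M(1) "3.prems"(3)] Nz M(4) by blast
  obtain tM where tM: "cM = M # tM" using cM by (cases cM) (auto simp: cone_def epath_def)
  have x: "cone x (x # cM) N" and z: "cone z (z # cM) N"
    using cone_Cons[OF cM] M xV by blast+
  have "path_hom edge ((z # r) @ tl d) cz"
    by (rule "3.IH"(2)[OF zr]) (use "3.prems" cz in auto)
  also have "path_hom edge cz (z # cM)" using cone_unique[OF cz z] .
  finally have "path_hom edge (x # (z # r) @ tl d) (x # z # cM)" by (rule path_hom_Cons)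
  \<comment> \<open>The edge from x to z is rerouted through M, after which M, z, M is a
    backtrack.\<close>
  also have "path_hom edge (x # z # cM) ([x, M, z] @ cM)"
    using path_hom_append_right[OF M(7), of cM] by simp
  also have "[x, M, z] @ cM = x # M # z # M # tM" using tM by simp
  also have "path_hom edge (x # M # z # M # tM) (x # M # tM)"
    by (rule path_hom_backtrack2) (use M(6) in blast)
  also have "x # M # tM = x # cM" using tM by simp
  also have "path_hom edge (x # cM) c" using cone_unique[OF x] "3.prems"(5) .
  finally show ?case using a by simp
qed

lemma common_refinement:
  assumes "finite M" "M \<subseteq> vertices" "p \<in> vertices"
  obtains N where "N \<in> vertices" "\<And>m. m \<in> M \<Longrightarrow> ker N \<subseteq> ker m"
proof -
  obtain w where w: "\<forall>m \<in> M. block_word w (ker p) \<subseteq> ker m"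
    using common_refining_word[OF assms] by blast
  obtain u N where "N \<in> vertices" "ker N = ker p \<inter> block_word w (ker p)"
    using cone_block_word[OF assms(3) equiv_ker_vertex[OF assms(3)] subset_refl] by blast
  then show ?thesis using that w by blast
qed

text \<open>Prolonged by one cone from y to N, both paths become homotopic to the cone from x, and
  the prolongation cancels. The complex of vertices is thus simply connected.\<close>

theorem path_hom_unique:
  assumes "epath edge x u y" "epath edge x v y" "set u \<subseteq> vertices" "set v \<subseteq> vertices"
  shows "path_hom edge u v"
proof -
  have xy: "x \<in> set u" "y \<in> set u" using assms(1) by (auto simp: epath_def)
  obtain N where N: "N \<in> vertices" "\<And>m. m \<in> set u \<union> set v \<Longrightarrow> ker N \<subseteq> ker m"
    using common_refinement[of "set u \<union> set v" x] assms xy by blast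
  obtain c where c: "cone x c N" using cone_exists[of x N] N xy assms by blast
  obtain d where d: "cone y d N" using cone_exists[of y N] N xy assms by blast
  have "path_hom edge (u @ tl d) c" by (rule path_hom_cone) (use assms N c d in auto)
  moreover have "path_hom edge (v @ tl d) c" by (rule path_hom_cone) (use assms N c d in auto)
  ultimately have "path_hom edge (u @ tl d) (v @ tl d)" by (meson path_hom.hom_sym path_hom.hom_trans)
  moreover have "epath edge y d N" using d by (simp add: cone_def)
  ultimately show ?thesis using path_hom_append_cancel[OF assms(1,2)] by blast
qed

theorem path_exists:
  assumes "x \<in> vertices" "y \<in> vertices"
  obtains u where "epath edge x u y"
proof -
  obtain N where N: "N \<in> vertices" "\<And>m. m \<in> {x, y} \<Longrightarrow> ker N \<subseteq> ker m"
    using common_refinement[of "{x, y}" x] assms by blast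
  obtain c where c: "cone x c N" using cone_exists[of x N] N assms by blast
  obtain d where d: "cone y d N" using cone_exists[of y N] N assms by blast
  have xN: "epath edge x c N" and yN: "epath edge y d N" using c d by (simp_all add: cone_def)
  show ?thesis using epath_append[OF xN epath_rev[OF yN]] by (rule that)
qed

end

subsection \<open>Homotopy of step sequences in context\<close>

definition step_target :: "'o \<Rightarrow> ('m \<Rightarrow> 'o) \<Rightarrow> ('m \<Rightarrow> 'o) \<Rightarrow> ('m \<times> bool) list \<Rightarrow> 'o" where
  "step_target a src tgt p = foldl (\<lambda>_. step_end src tgt) a p"

lemma step_target_simps [simp]:
  "step_target a src tgt [] = a"
  "step_target a src tgt (s # p) = step_target (step_end src tgt s) src tgt p"
  "step_target a src tgt (p @ q) = step_target (step_target a src tgt p) src tgt q"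
  by (simp_all add: step_target_def)

lemma composable_append:
  "composable src tgt H a (p @ q) \<longleftrightarrow>
    composable src tgt H a p \<and> composable src tgt H (step_target a src tgt p) q"
  by (induction p arbitrary: a) auto

locale nerve =
  fixes src tgt :: "'m \<Rightarrow> 'o" and cmp :: "'m \<Rightarrow> 'm \<Rightarrow> 'm" and H :: "'m set"
  assumes src_cmp: "src (cmp g f) = src f" and tgt_cmp: "tgt (cmp g f) = tgt g"
begin

abbreviation comp_seq :: "'o \<Rightarrow> ('m \<times> bool) list \<Rightarrow> bool" where
  "comp_seq \<equiv> composable src tgt H"

abbreviation target :: "'o \<Rightarrow> ('m \<times> bool) list \<Rightarrow> 'o" where
  "target a p \<equiv> step_target a src tgt p"

text \<open>Quantifying over the surrounding sequences makes \<open>sim\<close> a congruence by definition.\<close>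

definition sim :: "'o \<Rightarrow> ('m \<times> bool) list \<Rightarrow> ('m \<times> bool) list \<Rightarrow> bool" where
  "sim c p q \<longleftrightarrow> (\<forall>a A B. target a A = c \<longrightarrow>
     comp_seq a (A @ p @ B) = comp_seq a (A @ q @ B) \<and>
     (comp_seq a (A @ p @ B) \<longrightarrow> nerve_homotopic src tgt cmp H a (A @ p @ B) (A @ q @ B)))"

lemma sim_refl [simp]: "sim c p p"
  by (simp add: sim_def nerve_homotopic_def)

lemma sim_sym:
  assumes "sim c p q"
  shows "sim c q p"
  unfolding sim_def
proof (intro allI impI)
  fix a A B assume "target a A = c"
  note assms[unfolded sim_def, rule_format, OF this, of B]
  then show "comp_seq a (A @ q @ B) = comp_seq a (A @ p @ B) \<and>
     (comp_seq a (A @ q @ B) \<longrightarrow> nerve_homotopic src tgt cmp H a (A @ q @ B) (A @ p @ B))"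
    unfolding nerve_homotopic_def
    using equivclp_sym[of "nerve_move src tgt cmp H" "(a, A @ p @ B)" "(a, A @ q @ B)"] by simp
qed

lemma sim_trans:
  assumes "sim c p q" "sim c q r"
  shows "sim c p r"
  unfolding sim_def
proof (intro allI impI)
  fix a A B assume "target a A = c"
  note assms[unfolded sim_def, rule_format, OF this, of B]
  then show "comp_seq a (A @ p @ B) = comp_seq a (A @ r @ B) \<and>
     (comp_seq a (A @ p @ B) \<longrightarrow> nerve_homotopic src tgt cmp H a (A @ p @ B) (A @ r @ B))"
    unfolding nerve_homotopic_def
    using equivclp_trans[of "nerve_move src tgt cmp H" "(a, A @ p @ B)" "(a, A @ q @ B)"
        "(a, A @ r @ B)"] by simp
qed

lemma sim_cong:
  assumes "sim c p q" "target a A = c"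
  shows "sim a (A @ p @ B) (A @ q @ B)"
  unfolding sim_def
proof (intro allI impI)
  fix a' A' B' assume "target a' A' = a"
  then have "target a' (A' @ A) = c" using assms(2) by simp
  then show "comp_seq a' (A' @ (A @ p @ B) @ B') = comp_seq a' (A' @ (A @ q @ B) @ B') \<and>
     (comp_seq a' (A' @ (A @ p @ B) @ B') \<longrightarrow>
      nerve_homotopic src tgt cmp H a' (A' @ (A @ p @ B) @ B') (A' @ (A @ q @ B) @ B'))"
    using assms(1)[unfolded sim_def, rule_format, of a' "A' @ A" "B @ B'"] by simp
qed

lemma sim_Cons: "sim (step_end src tgt s) p q \<Longrightarrow> sim a (s # p) (s # q)"
  using sim_cong[of "step_end src tgt s" p q a "[s]" "[]"] by simp

lemma sim_append_right: "sim a p q \<Longrightarrow> sim a (p @ r) (q @ r)"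
  using sim_cong[of a p q a "[]" r] by simp

lemma sim_homotopic: "sim a p q \<Longrightarrow> comp_seq a p \<Longrightarrow> nerve_homotopic src tgt cmp H a p q"
  unfolding sim_def by (elim allE[of _ a] allE[of _ "[]"]) auto

lemma sim_backtrack:
  assumes "\<phi> \<in> H" "step_start src tgt (\<phi>, d) = c"
  shows "sim c [(\<phi>, d), (\<phi>, \<not> d)] []"
  unfolding sim_def
proof (intro allI impI)
  fix a A B assume t: "target a A = c"
  let ?p = "[(\<phi>, d), (\<phi>, \<not> d)]"
  have *: "comp_seq a (A @ ?p @ B) = comp_seq a (A @ [] @ B)"
    using assms t by (auto simp: composable_append step_start_def step_end_def)
  moreover have "nerve_homotopic src tgt cmp H a (A @ ?p @ B) (A @ [] @ B)"
    if "comp_seq a (A @ ?p @ B)"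
    unfolding nerve_homotopic_def using that *
    by (intro r_into_equivclp) (auto simp: nerve_move_def)
  ultimately show "comp_seq a (A @ ?p @ B) = comp_seq a (A @ [] @ B) \<and>
     (comp_seq a (A @ ?p @ B) \<longrightarrow> nerve_homotopic src tgt cmp H a (A @ ?p @ B) (A @ [] @ B))"
    by blast
qed

lemma sim_triangle:
  assumes "f \<in> H" "g \<in> H" "cmp g f \<in> H" "tgt f = src g" "src f = c"
  shows "sim c [(cmp g f, True)] [(f, True), (g, True)]"
  unfolding sim_def
proof (intro allI impI)
  fix a A B assume t: "target a A = c"
  let ?p = "[(cmp g f, True)]" and ?q = "[(f, True), (g, True)]"
  have *: "comp_seq a (A @ ?p @ B) = comp_seq a (A @ ?q @ B)"
    using assms t by (auto simp: composable_append step_start_def step_end_def src_cmp tgt_cmp)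
  moreover have "nerve_homotopic src tgt cmp H a (A @ ?p @ B) (A @ ?q @ B)"
    if "comp_seq a (A @ ?p @ B)"
    unfolding nerve_homotopic_def
  proof (rule r_into_equivclp)
    show "nerve_move src tgt cmp H (a, A @ ?p @ B) (a, A @ ?q @ B)"
      using that[unfolded *] that assms unfolding nerve_move_def fst_conv snd_conv by blast
  qed
  ultimately show "comp_seq a (A @ ?p @ B) = comp_seq a (A @ ?q @ B) \<and>
     (comp_seq a (A @ ?p @ B) \<longrightarrow> nerve_homotopic src tgt cmp H a (A @ ?p @ B) (A @ ?q @ B))"
    by blast
qed

end

subsection \<open>Transition morphisms\<close>

lemma mcomp_assoc:
  assumes "is_mor S m" "is_mor S n" "is_mor S l" "mtgt m = msrc n" "mtgt n = msrc l"
  shows "mcomp l (mcomp n m) = mcomp (mcomp l n) m"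
proof (rule mor_eqI'[of S])
  fix x assume "x \<in> snd (msrc (mcomp l (mcomp n m)))"
  then show "mfun (mcomp l (mcomp n m)) x = mfun (mcomp (mcomp l n) m) x"
    using mfun_in[OF assms(1), of x] assms(4) by (simp add: mfun_mcomp)
qed (use assms in \<open>simp_all add: is_mor_mcomp\<close>)

lemma mcomp_mident_left: "is_mor S m \<Longrightarrow> mcomp (mident (mtgt m)) m = m"
  by (rule mor_eqI'[OF is_mor_mcomp[OF _ is_mor_mident]])
    (auto simp: is_morD mfun_mcomp mfun_mident mfun_in)

locale markov_component = markov_base S b for S :: "'g::group_add set" and b +
  fixes A :: "'g obj"
  assumes b_comp: "b \<in> comp_obj S A"
begin

definition Hs :: "'g mor set" where "Hs = Hmor S \<inter> comp_mor S A"

sublocale nerve msrc mtgt mcomp Hs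
  by unfold_locales simp_all

text \<open>The only morphism whose composite with m is n. The vertices act as points of a covering
  of the nerve, with m lying over \<open>mtgt m\<close>.\<close>

definition transit :: "'g mor \<Rightarrow> 'g mor \<Rightarrow> 'g mor" where "transit m n = mcomp n (minv m)"

lemma transit_mor: "m \<in> vertices \<Longrightarrow> n \<in> vertices \<Longrightarrow> is_mor S (transit m n)"
  unfolding transit_def by (rule is_mor_mcomp) (auto simp: vertexD is_mor_minv)

lemma msrc_transit [simp]: "msrc (transit m n) = mtgt m" and mtgt_transit [simp]: "mtgt (transit m n) = mtgt n"
  by (simp_all add: transit_def)

lemma transit_apply: "m \<in> vertices \<Longrightarrow> n \<in> vertices \<Longrightarrow> x \<in> X \<Longrightarrow> mfun (transit m n) (mfun m x) = mfun n x"
  using mfun_minv_mfun[of S m x] mfun_in[of S m x] by (simp add: transit_def mfun_mcomp vertexD)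

lemma vertex_surj:
  assumes "m \<in> vertices" "y \<in> snd (mtgt m)"
  obtains x where "x \<in> X" "y = mfun m x"
  using mfun_surj[OF vertexD(1)[OF assms(1)] assms(2)] vertexD(2)[OF assms(1)] by metis

lemma transit_eqI:
  assumes "m \<in> vertices" "n \<in> vertices" "is_mor S f" "msrc f = mtgt m" "mtgt f = mtgt n"
    and "\<And>x. x \<in> X \<Longrightarrow> mfun f (mfun m x) = mfun n x"
  shows "f = transit m n"
proof (rule mor_eqI'[OF assms(3) transit_mor[OF assms(1,2)]])
  fix y assume "y \<in> snd (msrc f)"
  then obtain x where "x \<in> X" "y = mfun m x" using vertex_surj[OF assms(1), of y] assms(4) by auto
  then show "mfun f y = mfun (transit m n) y" using assms(6) transit_apply[OF assms(1,2)] by simp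
qed (use assms in auto)

lemma mfun_in_vertex: "m \<in> vertices \<Longrightarrow> x \<in> X \<Longrightarrow> mfun m x \<in> snd (mtgt m)"
  using mfun_in[of S m x] by (simp add: vertexD)

lemma mcomp_transit:
  assumes "m \<in> vertices" "n \<in> vertices" "l \<in> vertices"
  shows "mcomp (transit n l) (transit m n) = transit m l"
  by (rule transit_eqI) (use assms in \<open>auto simp: transit_mor is_mor_mcomp mfun_mcomp mfun_in_vertex transit_apply\<close>)

lemma minv_transit:
  assumes "m \<in> vertices" "n \<in> vertices"
  shows "minv (transit m n) = transit n m"
proof (rule transit_eqI)
  fix x assume x: "x \<in> X"
  have "mfun (minv (transit m n)) (mfun (transit m n) (mfun m x)) = mfun m x"
    using mfun_minv_mfun[OF transit_mor[OF assms]] mfun_in_vertex[OF assms(1) x] by simp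
  then show "mfun (minv (transit m n)) (mfun n x) = mfun m x" using transit_apply[OF assms x] by simp
qed (use assms in \<open>auto simp: is_mor_minv transit_mor\<close>)

lemma transit_self: "m \<in> vertices \<Longrightarrow> transit m m = mident (mtgt m)"
  by (rule sym, rule transit_eqI) (auto simp: is_mor_mident is_morD vertexD mfun_mident mfun_in_vertex)

lemma transit_mcomp:
  assumes "m \<in> vertices" "is_mor S f" "msrc f = mtgt m"
  shows "mcomp f m \<in> vertices" "transit m (mcomp f m) = f"
proof -
  show *: "mcomp f m \<in> vertices" using assms vertexD[OF assms(1)] is_mor_mcomp[of S m f] by (simp add: vertices_def)
  show "transit m (mcomp f m) = f"
    by (rule sym, rule transit_eqI) (use assms * in \<open>auto simp: mfun_mcomp vertexD\<close>)
qed

text \<open>As x runs over X, \<open>mfun m x\<close> runs over the source of the transition, and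
  agreement of two such points on T means lying in the T-block refinement of
  \<open>ker m\<close>.\<close>

lemma nbhd_transit:
  assumes "m \<in> vertices" "n \<in> vertices"
  shows "has_nbhd T (transit m n) \<longleftrightarrow> block X T (ker m) \<subseteq> ker n"
proof -
  have "snd (mtgt m) = mfun m ` X"
    using mfun_in_vertex[OF assms(1)] vertex_surj[OF assms(1)] by blast
  then have "has_nbhd T (transit m n) \<longleftrightarrow> (\<forall>x\<in>X. \<forall>y\<in>X. (\<forall>t\<in>T. mfun m x t = mfun m y t) \<longrightarrow>
      mfun (transit m n) (mfun m x) 0 = mfun (transit m n) (mfun m y) 0)"
    unfolding has_nbhd_iff[OF transit_mor[OF assms]] msrc_transit by simp
  also have "\<dots> \<longleftrightarrow> block X T (ker m) \<subseteq> ker n"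
    unfolding block_ker[OF assms(1)] using assms by (auto simp: transit_apply ker_def vertexD)
  finally show ?thesis .
qed

lemma mtgt_comp:
  assumes m: "m \<in> vertices"
  shows "mtgt m \<in> comp_obj S A"
proof -
  obtain f where f: "is_mor S f" "msrc f = A" "mtgt f = b" using b_comp by (auto simp: comp_obj_def)
  then have "is_mor S (mcomp m f)" using is_mor_mcomp vertexD[OF m] by metis
  then show ?thesis unfolding comp_obj_def mem_Collect_eq using f by (intro exI[of _ "mcomp m f"]) simp
qed

lemma transit_Hs_iff:
  assumes "m \<in> vertices" "n \<in> vertices"
  shows "transit m n \<in> Hs \<longleftrightarrow> edge m n"
  using assms
  by (simp add: Hs_def Hmor_def comp_mor_def transit_mor minv_transit nbhd_transit mtgt_comp edge_def)

section \<open>Step sequences lying under vertex paths\<close>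

lemma edge_vertices: "adj edge m n \<Longrightarrow> m \<in> vertices \<and> n \<in> vertices"
  by (auto simp: edge_def)

lemma epath_prefix: "epath edge x (u @ v) y \<Longrightarrow> u \<noteq> [] \<Longrightarrow> epath edge x u (last u)"
  by (simp add: epath_def successively_append_iff)

lemma epath_vertices:
  assumes "epath edge x u y" "x \<in> vertices"
  shows "set u \<subseteq> vertices"
  using assms
proof (induction u arbitrary: x rule: induct_list012)
  case (3 a z r)
  then have "a = x" "adj edge x z" "epath edge z (z # r) y" by (auto simp: epath_def)
  then show ?case using "3.IH"(2)[of z] "3.prems"(2) edge_vertices[of x z] by simp
qed (auto simp: epath_def)

text \<open>If m and n are joined both ways the forward step is chosen; \<open>lift_steps\<close>
  compares it with the backward one.\<close>

definition step :: "'g mor \<Rightarrow> 'g mor \<Rightarrow> 'g mor \<times> bool" where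
  "step m n = (if edge m n then (transit m n, True) else (transit n m, False))"

fun steps :: "'g mor list \<Rightarrow> ('g mor \<times> bool) list" where
  "steps (x # y # r) = step x y # steps (y # r)"
| "steps _ = []"

lemma steps_append: "steps (p @ x # q) = steps (p @ [x]) @ steps (x # q)"
proof (induction p rule: induct_list012)
  case (3 y z p)
  then show ?case by simp
qed (cases q; simp)+

lemma step_start_step: "step_start msrc mtgt (step m n) = mtgt m"
  and step_end_step: "step_end msrc mtgt (step m n) = mtgt n"
  by (simp_all add: step_def step_start_def step_end_def)

lemma step_mor_step: "adj edge m n \<Longrightarrow> step_mor minv (step m n) = transit m n"
  using edge_vertices by (auto simp: step_def step_mor_def minv_transit)

lemma step_Hs: "adj edge m n \<Longrightarrow> fst (step m n) \<in> Hs"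
  using edge_vertices[of m n] transit_Hs_iff by (auto simp: step_def)

lemma steps_path:
  assumes "epath edge x u y" "x \<in> vertices"
  shows "comp_seq (mtgt x) (steps u)" "target (mtgt x) (steps u) = mtgt y"
    "composite msrc mtgt mcomp mident minv (mtgt x) (steps u) = transit x y" "y \<in> vertices"
proof -
  have "comp_seq (mtgt x) (steps u) \<and> target (mtgt x) (steps u) = mtgt y \<and>
    composite msrc mtgt mcomp mident minv (mtgt x) (steps u) = transit x y \<and> y \<in> vertices"
    using assms
  proof (induction u arbitrary: x rule: induct_list012)
    case 1
    then show ?case by (simp add: epath_def)
  next
    case (2 z)
    then have "z = x" "y = x" by (auto simp: epath_def)
    then show ?case using 2 by (simp add: transit_self)
  next
    case (3 a z r)
    have a: "a = x" and xz: "adj edge x z" and zr: "epath edge z (z # r) y"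
      using "3.prems"(1) by (auto simp: epath_def)
    have zV: "z \<in> vertices" using edge_vertices[OF xz] by blast
    show ?case
      using "3.IH"(2)[OF zr zV] a step_Hs[OF xz] mcomp_transit[OF "3.prems"(2) zV]
      by (simp add: step_start_step step_end_step step_mor_step[OF xz])
  qed
  then show "comp_seq (mtgt x) (steps u)" "target (mtgt x) (steps u) = mtgt y"
    "composite msrc mtgt mcomp mident minv (mtgt x) (steps u) = transit x y" "y \<in> vertices" by auto
qed

lemma sim_transit_triangle:
  assumes "edge x y" "edge y z" "edge x z"
  shows "sim (mtgt x) [(transit x z, True)] [(transit x y, True), (transit y z, True)]"
proof -
  have vertices: "x \<in> vertices" "y \<in> vertices" "z \<in> vertices" using assms by (auto simp: edge_def)
  show ?thesis
    using sim_triangle[of "transit x y" "transit y z" "mtgt x"] assms vertices by (simp add: transit_Hs_iff mcomp_transit)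
qed

text \<open>The degenerate triangle x, x, x identifies the identity loop with its own square;
  cancelling one copy against its reverse leaves the empty sequence.\<close>

lemma sim_transit_self:
  assumes "x \<in> vertices"
  shows "sim (mtgt x) [(transit x x, True)] []"
proof -
  have x: "edge x x" using edge_same_kernel[OF assms assms] by simp
  let ?s = "(transit x x, True)" and ?s' = "(transit x x, \<not> True)"
  have undo: "sim (mtgt x) [?s, ?s'] []"
    by (rule sim_backtrack) (use x assms in \<open>auto simp: transit_Hs_iff step_start_def\<close>)
  have "sim (mtgt x) ([?s] @ [?s']) ([?s, ?s] @ [?s'])"
    by (rule sim_append_right) (rule sim_transit_triangle[OF x x x])
  moreover have "sim (mtgt x) ([?s] @ [?s, ?s'] @ []) ([?s] @ [] @ [])"
    by (rule sim_cong[OF undo]) (simp add: step_end_def)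
  ultimately show ?thesis using undo sim_trans sim_sym by (metis append_Cons append_Nil append_Nil2)
qed

text \<open>If edges run both ways, both steps are forward and do not form a formal backtrack; the
  triangle x, y, x then reduces them to the identity loop.\<close>

lemma sim_step_step:
  assumes "adj edge x y"
  shows "sim (mtgt x) [step x y, step y x] []"
proof (cases "edge x y \<and> edge y x")
  case True
  have vertices: "x \<in> vertices" using True by (simp add: edge_def)
  have "sim (mtgt x) [(transit x x, True)] [step x y, step y x]"
    using sim_transit_triangle[of x y x] True edge_same_kernel[OF vertices vertices] by (simp add: step_def)
  then show ?thesis using sim_transit_self[OF vertices] sim_trans sim_sym by blast
next
  case False
  then consider "edge x y" "\<not> edge y x" | "edge y x" "\<not> edge x y" using assms by blast
  then show ?thesis
  proof cases
    case 1
    then show ?thesis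
      using sim_backtrack[of "transit x y" True "mtgt x"] edge_vertices[OF assms]
      by (simp add: step_def step_start_def transit_Hs_iff)
  next
    case 2
    then show ?thesis
      using sim_backtrack[of "transit y x" False "mtgt x"] edge_vertices[OF assms]
      by (simp add: step_def step_start_def transit_Hs_iff)
  qed
qed

text \<open>The replaced stretch starts and ends at the same vertices as before, so the steps around
  it are unchanged and \<open>sim_cong\<close> applies.\<close>

lemma steps_local:
  assumes "sim (mtgt x) (steps (x # v)) (steps (x # v'))" "epath edge w (p @ x # v) y" "w \<in> vertices"
    and "last (x # v) = last (x # v')"
  shows "sim (mtgt w) (steps (p @ (x # v) @ q)) (steps (p @ (x # v') @ q))"
proof -
  have split: "steps (p @ (x # t) @ q) = steps (p @ [x]) @ steps (x # t) @ steps (last (x # t) # q)" for t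
  proof -
    have "(x # t) @ q = butlast (x # t) @ last (x # t) # q"
      by (metis append.assoc append_Cons append_Nil append_butlast_last_id list.distinct(1))
    then have "steps ((x # t) @ q) = steps (x # t) @ steps (last (x # t) # q)"
      by (metis append_butlast_last_id list.distinct(1) steps_append)
    then show ?thesis using steps_append[of p x "t @ q"] by simp
  qed
  have "epath edge w (p @ [x]) x"
    using epath_prefix[of w "p @ [x]" v y] assms(2) by simp
  then have "target (mtgt w) (steps (p @ [x])) = mtgt x" using steps_path assms(3) by blast
  then show ?thesis
    unfolding split using sim_cong[OF assms(1)] assms(4) by simp
qed

lemma path_hom_sim:
  assumes "path_hom edge u v" "epath edge w u y" "w \<in> vertices"
  shows "sim (mtgt w) (steps u) (steps v)"
  using assms
proof (induction rule: path_hom.induct)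
  case (hom_sym u v)
  then show ?case using path_hom_epath[OF hom_sym.hyps] sim_sym by blast
next
  case (hom_trans u v v')
  then show ?case using path_hom_epath[OF hom_trans.hyps(1)] sim_trans by blast
next
  case (hom_back x z p q)
  have "epath edge w (p @ x # [z, x]) x"
    using epath_prefix[of w "p @ [x, z, x]" q y] hom_back.prems(1) by simp
  moreover have "sim (mtgt x) (steps (x # [z, x])) (steps (x # []))"
    using sim_step_step[OF hom_back.hyps] by simp
  ultimately show ?case
    using steps_local[of x "[z, x]" "[]" w p x q] hom_back.prems(2) by simp
next
  case (hom_tri x z z' p q)
  have "epath edge w (p @ x # [z, z']) z'"
    using epath_prefix[of w "p @ [x, z, z']" q y] hom_tri.prems(1) by simp
  moreover have "sim (mtgt x) (steps (x # [z, z'])) (steps (x # [z']))"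
    using sim_sym[OF sim_transit_triangle[OF hom_tri.hyps]] hom_tri.hyps by (simp add: step_def)
  ultimately show ?case
    using steps_local[of x "[z, z']" "[z']" w p z' q] hom_tri.prems(2) by simp
qed simp

text \<open>Path lifting: composing m with the successive morphisms of p gives the vertices of the
  lift. Its end depends only on the composite, so sequences with equal composites lift to paths with
  equal ends.\<close>

lemma lift_steps:
  assumes "comp_seq (mtgt m) p" "m \<in> vertices"
  shows "\<exists>u. epath edge m u (mcomp (composite msrc mtgt mcomp mident minv (mtgt m) p) m) \<and>
    is_mor S (composite msrc mtgt mcomp mident minv (mtgt m) p) \<and>
    msrc (composite msrc mtgt mcomp mident minv (mtgt m) p) = mtgt m \<and>
    sim (mtgt m) (steps u) p"
  using assms
proof (induction p arbitrary: m)
  case Nil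
  have "epath edge m [m] m" by (simp add: epath_def)
  moreover have "sim (mtgt m) (steps [m]) []" by simp
  ultimately show ?case
    using mcomp_mident_left[OF vertexD(1)[OF Nil(2)]] is_mor_mident[OF is_morD(2)[OF vertexD(1)[OF Nil(2)]]]
    by fastforce
next
  case (Cons s p)
  let ?C = "composite msrc mtgt mcomp mident minv"
  obtain \<phi> d where s: "s = (\<phi>, d)" by (cases s)
  define f where "f = step_mor minv s"
  have \<phi>: "\<phi> \<in> Hs" "is_mor S \<phi>" using Cons.prems(1) s by (auto simp: Hs_def Hmor_def)
  have f: "is_mor S f" "msrc f = mtgt m" "mtgt f = step_end msrc mtgt s"
    using Cons.prems(1) \<phi> s
    by (auto simp: f_def step_mor_def step_start_def step_end_def is_mor_minv split: if_splits)
  define n where "n = mcomp f m"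
  have n: "n \<in> vertices" "transit m n = f" "mtgt n = step_end msrc mtgt s"
    using transit_mcomp[OF Cons.prems(2) f(1,2)] f(3) by (simp_all add: n_def)
  have "comp_seq (mtgt n) p" using Cons.prems(1) n(3) by simp
  then obtain u where u: "epath edge n u (mcomp (?C (mtgt n) p) n)" "is_mor S (?C (mtgt n) p)"
    "msrc (?C (mtgt n) p) = mtgt n" "sim (mtgt n) (steps u) p"
    using Cons.IH[OF _ n(1)] by blast
  have en: "if d then edge m n \<and> transit m n = \<phi> else edge n m \<and> transit n m = \<phi>"
  proof (cases d)
    case True
    then have "transit m n = \<phi>" using n(2) by (simp add: f_def s step_mor_def)
    then show ?thesis using True \<phi>(1) transit_Hs_iff[OF Cons.prems(2) n(1)] by simp
  next
    case False
    then have "transit m n = minv \<phi>" using n(2) by (simp add: f_def s step_mor_def)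
    then have "transit n m = minv (minv \<phi>)" using minv_transit[OF Cons.prems(2) n(1)] by simp
    moreover have "minv (minv \<phi>) = \<phi>"
    proof (rule mor_eqI'[OF is_mor_minv[OF is_mor_minv[OF \<phi>(2)]] \<phi>(2)])
      fix x assume "x \<in> snd (msrc (minv (minv \<phi>)))"
      then have x: "x \<in> snd (msrc \<phi>)" by simp
      then show "mfun (minv (minv \<phi>)) x = mfun \<phi> x"
        using mfun_minv_mfun[OF is_mor_minv[OF \<phi>(2)], of "mfun \<phi> x"] mfun_minv_mfun[OF \<phi>(2) x]
          mfun_in[OF \<phi>(2) x] by simp
    qed simp_all
    ultimately show ?thesis using False \<phi>(1) transit_Hs_iff[OF n(1) Cons.prems(2)] by simp
  qed
  have adj: "adj edge m n" using en by (cases d) auto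
  obtain t where t: "u = n # t" using u(1) by (cases u) (auto simp: epath_def)
  \<comment> \<open>The chosen step differs from s only if s runs backward while a forward edge
    exists too. Then consider \<open>step m n\<close>, \<open>step n m\<close>, s in a row:
    cancelling the last two leaves the chosen step, cancelling the first two leaves s.\<close>
  have "sim (mtgt m) [step m n] [s]"
  proof (cases "step m n = s")
    case False
    then have nd: "\<not> d" "edge m n" "edge n m" "transit n m = \<phi>"
      using en s by (auto simp: step_def split: if_splits)
    then have step: "step m n = (transit m n, True)" "step n m = (\<phi>, True)" "s = (\<phi>, False)"
      using s by (auto simp: step_def)
    have "sim (mtgt n) [(\<phi>, True), (\<phi>, \<not> True)] []"
      by (rule sim_backtrack) (use \<phi> nd in \<open>auto simp: step_start_def\<close>)
    then have "sim (mtgt m) ([step m n] @ [step n m, s] @ []) ([step m n] @ [] @ [])"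
      by (intro sim_cong) (use step in \<open>simp_all add: step_end_def\<close>)
    then have 1: "sim (mtgt m) [step m n, step n m, s] [step m n]" by simp
    have "sim (mtgt m) ([step m n, step n m] @ [s]) ([] @ [s])"
      by (rule sim_append_right[OF sim_step_step[OF adj]])
    then have 2: "sim (mtgt m) [step m n, step n m, s] [s]" by simp
    show ?thesis by (rule sim_trans[OF sim_sym[OF 1] 2])
  qed simp
  then have "sim (mtgt m) ([step m n] @ steps u) ([s] @ steps u)" by (rule sim_append_right)
  moreover have "sim (mtgt m) (s # steps u) (s # p)"
    by (rule sim_Cons) (use u(4) n(3) in simp)
  ultimately have "sim (mtgt m) (steps (m # u)) (s # p)" using sim_trans t by fastforce
  moreover have "epath edge m (m # u) (mcomp (?C (mtgt n) p) n)"
    using u(1) adj t by (auto simp: epath_def)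
  moreover have "mcomp (?C (mtgt n) p) n = mcomp (?C (mtgt m) (s # p)) m"
    using mcomp_assoc[OF vertexD(1)[OF Cons.prems(2)] f(1) u(2)] f n u(3) by (simp add: f_def n_def)
  moreover have "is_mor S (?C (mtgt m) (s # p))" "msrc (?C (mtgt m) (s # p)) = mtgt m"
    using is_mor_mcomp[OF f(1) u(2)] f n u(3) by (simp_all add: f_def)
  ultimately show ?case by auto
qed

section \<open>Generation and uniqueness at the base object\<close>

lemma mident_vertex: "mident b \<in> vertices"
  using is_mor_mident[OF b_Obj] by (simp add: vertices_def)

lemma generates_from_base:
  assumes "is_mor S m" "msrc m = b"
  shows "\<exists>p. comp_seq b p \<and> composite msrc mtgt mcomp mident minv b p = m"
proof -
  have m: "m \<in> vertices" using assms by (simp add: vertices_def)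
  obtain u where u: "epath edge (mident b) u m" using path_exists[OF mident_vertex m] .
  \<comment> \<open>Starting from the identity vertex, the composite of a path ending at m is m
    itself.\<close>
  have "m = transit (mident b) m"
    by (rule transit_eqI[OF mident_vertex m assms(1)]) (use assms in \<open>simp_all add: mfun_mident\<close>)
  then show ?thesis using steps_path[OF u mident_vertex] by (intro exI[of _ "steps u"]) simp
qed

lemma homotopic_from_base:
  assumes "comp_seq b p" "comp_seq b q"
    and "composite msrc mtgt mcomp mident minv b p = composite msrc mtgt mcomp mident minv b q"
  shows "nerve_homotopic msrc mtgt mcomp Hs b p q"
proof -
  let ?y = "mcomp (composite msrc mtgt mcomp mident minv b p) (mident b)"
  obtain u where u: "epath edge (mident b) u ?y" "sim b (steps u) p"
    using lift_steps[OF _ mident_vertex, of p] assms(1) by auto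
  obtain v where v: "epath edge (mident b) v ?y" "sim b (steps v) q"
    using lift_steps[OF _ mident_vertex, of q] assms(2,3) by auto
  have "set u \<subseteq> vertices" "set v \<subseteq> vertices" using epath_vertices u(1) v(1) mident_vertex by auto
  then have "path_hom edge u v" using path_hom_unique[OF u(1) v(1)] by blast
  then have "sim b (steps u) (steps v)" using path_hom_sim[OF _ u(1) mident_vertex] by simp
  then have "sim b p q" using u(2) v(2) sim_sym sim_trans by meson
  then show ?thesis using sim_homotopic assms(1) by blast
qed

lemma mident_Hs: "mident b \<in> Hs"
  using transit_Hs_iff[OF mident_vertex mident_vertex] transit_self[OF mident_vertex] edge_same_kernel[OF mident_vertex mident_vertex] by simp

end

theorem mainTheorem4:
  fixes S :: "'g::group_add set" and k :: nat and X :: "('g \<Rightarrow> nat) set"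
  assumes "finite S" and "0 \<in> S" and "generates_group S"
    and "1 \<le> k" and "is_markov_shift S k X"
  shows "homotopically_uniquely_generates (comp_obj S (k, X)) (comp_mor S (k, X))
           msrc mtgt mcomp mident minv (Hmor S \<inter> comp_mor S (k, X))"
proof -
  \<comment> \<open>Sequences may start at any object of the component, so each object serves as
    base in turn.\<close>
  have comp: "markov_component S a (k, X)" if "a \<in> comp_obj S (k, X)" for a
    using that assms is_morD(2) by unfold_locales (auto simp: comp_obj_def)
  show ?thesis
    unfolding homotopically_uniquely_generates_def gpd_generates_def
  proof (intro conjI ballI allI impI)
    fix a assume a: "a \<in> comp_obj S (k, X)"
    interpret markov_component S a "(k, X)" using comp[OF a] .
    show "mident a \<in> Hmor S \<inter> comp_mor S (k, X)" using mident_Hs unfolding Hs_def .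
    show "nerve_homotopic msrc mtgt mcomp (Hmor S \<inter> comp_mor S (k, X)) a p q"
      if "composable msrc mtgt (Hmor S \<inter> comp_mor S (k, X)) a p"
        "composable msrc mtgt (Hmor S \<inter> comp_mor S (k, X)) a q"
        "composite msrc mtgt mcomp mident minv a p = composite msrc mtgt mcomp mident minv a q" for p q
      using homotopic_from_base[of p q] that unfolding Hs_def .
  next
    fix m assume m: "m \<in> comp_mor S (k, X)"
    then have a: "msrc m \<in> comp_obj S (k, X)" by (simp add: comp_mor_def)
    interpret markov_component S "msrc m" "(k, X)" using comp[OF a] .
    show "\<exists>p. composable msrc mtgt (Hmor S \<inter> comp_mor S (k, X)) (msrc m) p \<and>
        composite msrc mtgt mcomp mident minv (msrc m) p = m"
      using generates_from_base[of m] m unfolding Hs_def comp_mor_def by simp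
  qed simp
qed

end
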